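(* Let $\mathsf R$ and $\mathsf E$ be totally ordered finite sets with $|\mathsf R|=d\le n=|\mathsf E|$ and let $(M_\sigma)_{\sigma\in\binom{\mathsf E}{d}}$ be a polyhedral matching field. Let $\mathbb H$ be an arbitrary hyperfield and let $A=(A_e)_{e\in\mathsf R\times\mathsf E}$ be an $\mathbb H$-matrix with no zero entries. Let $\chi:\mathsf E^d\to\mathbb H$ be the alternating function given on $d$-subsets $\sigma$ of $\mathsf E$ by $\sigma\mapsto \operatorname{sign}(M_\sigma)\otimes\bigotimes_{e\in M_\sigma}A_e$. Then $\chi$ is a weak matroid over the canonical inflation $\widetilde{\mathbb H}$ of $\mathbb H$. In general, given a hyperfield morphism $\varphi:\mathbb H\to\mathbb H'$ where $\mathbb H'$ has the inflation property, $\varphi_*\chi:=\varphi\circ\chi$ is a weak matroid over $\mathbb H'$.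
   Context: **Polyhedral matching field.** $\triangle_{k-1}=\operatorname{conv}\{\mathbf e_1,\dots,\mathbf e_k\}\subset\mathbb R^k$. A triangulation of $\triangle_{d-1}\times\triangle_{n-1}$ is a collection of full-dimensional simplices with vertices among the vertices $(\mathbf e_i,\mathbf e_j)$, with union $\triangle_{d-1}\times\triangle_{n-1}$, any two intersecting in a common face. Identifying $\mathsf R\cong[d]$, $\mathsf E\cong[n]$ and $(\mathbf e_i,\mathbf e_j)$ with the edge $(i,j)$ of the complete bipartite graph $K_{\mathsf R,\mathsf E}$, each simplex becomes a spanning tree of $K_{\mathsf R,\mathsf E}$. For every $d$-subset $\sigma\subseteq\mathsf E$ there is exactly one perfect matching $M_\sigma$ between $\mathsf R$ and $\sigma$ contained in at least one of these trees; the family $(M_\sigma)$ is the polyhedral matching field of the triangulation. $\operatorname{sign}(M_\sigma)=\pm1$ is the sign of the permutation $[d]\to\mathsf R\to\sigma\to[d]$ (order-preserving bijections at both ends, $M_\sigma$ in the middle), viewed as $1$ or $-1$ in $\mathbb H$. **Hyperfield.** A hyperfield $(\mathbb H,\boxplus,\otimes,0,1)$ is a set with elements $0\ne1$, a hyperoperation $\boxplus:\mathbb H\times\mathbb H\to 2^{\mathbb H}\setminus\{\emptyset\}$ and an operation $\otimes:\mathbb H\times\mathbb H\to\mathbb H$ such that: $x\boxplus y=y\boxplus x$; $\bigcup_{a\in x\boxplus y}a\boxplus z=\bigcup_{b\in y\boxplus z}x\boxplus b=:x\boxplus y\boxplus z$; $0\boxplus x=\{x\}$; for each $x$ there is a unique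 $-x$ with $0\in x\boxplus(-x)$; $x\in y\boxplus z$ iff $z\in x\boxplus(-y)$; $(\mathbb H\setminus\{0\},\otimes,1)$ is an abelian group and $0\otimes x=x\otimes0=0$; $a\otimes(x\boxplus y)=(a\otimes x)\boxplus(a\otimes y)$. A hyperfield morphism $\varphi:\mathbb H\to\mathbb H'$ is a map with $\varphi(0)=0'$, $\varphi(1)=1'$, $\varphi(x\otimes y)=\varphi(x)\otimes'\varphi(y)$ and $\varphi(x\boxplus y)\subseteq\varphi(x)\boxplus'\varphi(y)$. $\mathbb H$ has the inflation property if $1\boxplus(-1)=\mathbb H$. **Canonical inflation.** $\widetilde{\mathbb H}$ is the hyperfield with the same ground set and multiplicative structure as $\mathbb H$ and hyperaddition $\widetilde\boxplus$ given by $a\widetilde\boxplus b=(a\boxplus b)\cup\{a,b\}$ for $a,b\ne0$, $a\ne-b$; $a\widetilde\boxplus(-a)=\mathbb H$ for $a\neq0$; and $0\widetilde\boxplus a=a\widetilde\boxplus 0=\{a\}$. (It is known to be a hyperfield.) **Weak matroid.** A weak matroid over $\mathbb H$ (on $\mathsf E$, of rank $d$) is given by a non-zero alternating function $\chi:\mathsf E^d\to\mathbb H$ such that $\{\sigma\in\binom{\mathsf E}{d}:\chi(\sigma)\ne0\}$ is the set of bases of a matroid and, for all $x_1,x_2,y_1,y_2\in\mathsf E$ and $X=\{x_3,\dots,x_d\}\subseteq\mathsf E$, $$0\in \chi(x_1,x_2,X)\chi(y_1,y_2,X)\boxplus\chi(x_1,y_1,X)\chi(y_2,x_2,X)\boxplus\chi(x_1,y_2,X)\chi(x_2,y_1,X),$$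 where juxtaposition denotes $\otimes$. For $\sigma=\{\sigma_1<\dots<\sigma_d\}$, $\chi(\sigma):=\chi(\sigma_1,\dots,\sigma_d)$, which determines the alternating function $\chi$. *)

theory Defs
  imports "HOL-Analysis.Polytope" "HOL-Algebra.FiniteProduct" "HOL-Combinatorics.Permutations"
begin

section \<open>Hyperfields\<close>

record 'a hyperstruct = "'a monoid" +
  hzero :: 'a
  hadd  :: "'a \<Rightarrow> 'a \<Rightarrow> 'a set"  (infixl \<open>\<boxplus>\<index>\<close> 65)

definition hneg :: "('a, 'm) hyperstruct_scheme \<Rightarrow> 'a \<Rightarrow> 'a" where
  "hneg H x = (THE y. y \<in> carrier H \<and> hzero H \<in> x \<boxplus>\<^bsub>H\<^esub> y)"

locale hyperfield =
  fixes H :: "('a, 'm) hyperstruct_scheme" (structure)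
  assumes zero_closed: "hzero H \<in> carrier H"
    and zero_neq_one: "hzero H \<noteq> \<one>"
    and hadd_closed: "\<lbrakk>x \<in> carrier H; y \<in> carrier H\<rbrakk> \<Longrightarrow> x \<boxplus> y \<subseteq> carrier H"
    and hadd_nonempty: "\<lbrakk>x \<in> carrier H; y \<in> carrier H\<rbrakk> \<Longrightarrow> x \<boxplus> y \<noteq> {}"
    and hadd_commute: "\<lbrakk>x \<in> carrier H; y \<in> carrier H\<rbrakk> \<Longrightarrow> x \<boxplus> y = y \<boxplus> x"
    and hadd_assoc: "\<lbrakk>x \<in> carrier H; y \<in> carrier H; z \<in> carrier H\<rbrakk>
          \<Longrightarrow> (\<Union>a\<in>x \<boxplus> y. a \<boxplus> z) = (\<Union>b\<in>y \<boxplus> z. x \<boxplus> b)"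
    and zero_hadd: "x \<in> carrier H \<Longrightarrow> hzero H \<boxplus> x = {x}"
    and neg_ex1: "x \<in> carrier H \<Longrightarrow> \<exists>!y. y \<in> carrier H \<and> hzero H \<in> x \<boxplus> y"
    and reversible: "\<lbrakk>x \<in> carrier H; y \<in> carrier H; z \<in> carrier H\<rbrakk>
          \<Longrightarrow> x \<in> y \<boxplus> z \<longleftrightarrow> z \<in> x \<boxplus> hneg H y"
    and nonzero_comm_group: "comm_group (H\<lparr>carrier := carrier H - {hzero H}\<rparr>)"
    and zero_mult: "x \<in> carrier H \<Longrightarrow> hzero H \<otimes> x = hzero H"
    and mult_zero: "x \<in> carrier H \<Longrightarrow> x \<otimes> hzero H = hzero H"
    and distrib: "\<lbrakk>a \<in> carrier H; x \<in> carrier H; y \<in> carrier H\<rbrakk>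
          \<Longrightarrow> (\<lambda>u. a \<otimes> u) ` (x \<boxplus> y) = (a \<otimes> x) \<boxplus> (a \<otimes> y)"

definition hadd3 :: "('a, 'm) hyperstruct_scheme \<Rightarrow> 'a \<Rightarrow> 'a \<Rightarrow> 'a \<Rightarrow> 'a set" where
  "hadd3 H x y z = (\<Union>a\<in>x \<boxplus>\<^bsub>H\<^esub> y. a \<boxplus>\<^bsub>H\<^esub> z)"

definition hyperfield_morphism ::
  "('a, 'm) hyperstruct_scheme \<Rightarrow> ('b, 'k) hyperstruct_scheme \<Rightarrow> ('a \<Rightarrow> 'b) \<Rightarrow> bool" where
  "hyperfield_morphism H H' \<phi> \<longleftrightarrow>
     \<phi> \<in> carrier H \<rightarrow> carrier H' \<and>
     \<phi> (hzero H) = hzero H' \<and>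
     \<phi> \<one>\<^bsub>H\<^esub> = \<one>\<^bsub>H'\<^esub> \<and>
     (\<forall>x\<in>carrier H. \<forall>y\<in>carrier H.
        \<phi> (x \<otimes>\<^bsub>H\<^esub> y) = \<phi> x \<otimes>\<^bsub>H'\<^esub> \<phi> y \<and>
        \<phi> ` (x \<boxplus>\<^bsub>H\<^esub> y) \<subseteq> \<phi> x \<boxplus>\<^bsub>H'\<^esub> \<phi> y)"

definition inflation_property :: "('a, 'm) hyperstruct_scheme \<Rightarrow> bool" where
  "inflation_property H \<longleftrightarrow> \<one>\<^bsub>H\<^esub> \<boxplus>\<^bsub>H\<^esub> hneg H \<one>\<^bsub>H\<^esub> = carrier H"

definition canonical_inflation ::
  "('a, 'm) hyperstruct_scheme \<Rightarrow> ('a, 'm) hyperstruct_scheme" where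
  "canonical_inflation H = H\<lparr>hadd := \<lambda>a b.
     if a = hzero H then {b}
     else if b = hzero H then {a}
     else if b = hneg H a then carrier H
     else (a \<boxplus>\<^bsub>H\<^esub> b) \<union> {a, b}\<rparr>"

text \<open>The sign of a permutation, which the library gives as an integer, read in \<open>H\<close>.\<close>

definition hsign :: "('a, 'm) hyperstruct_scheme \<Rightarrow> int \<Rightarrow> 'a" where
  "hsign H s = (if s = 1 then \<one>\<^bsub>H\<^esub> else hneg H \<one>\<^bsub>H\<^esub>)"


section \<open>Weak matroids over a hyperfield\<close>

definition matroid_bases :: "'e::finite set set \<Rightarrow> bool" where
  "matroid_bases \<B> \<longleftrightarrow> \<B> \<noteq> {} \<and>
     (\<forall>B\<in>\<B>. \<forall>B'\<in>\<B>. \<forall>x\<in>B - B'. \<exists>y\<in>B' - B. insert y (B - {x}) \<in> \<B>)"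

text \<open>A \<open>d\<close>-tuple of elements of \<open>E\<close> is a list of length \<open>d\<close>;
  the values of \<open>chi\<close> on lists of any other length are irrelevant.\<close>

definition alternating ::
  "('a, 'm) hyperstruct_scheme \<Rightarrow> nat \<Rightarrow> ('e list \<Rightarrow> 'a) \<Rightarrow> bool" where
  "alternating H d chi \<longleftrightarrow>
     (\<forall>xs. length xs = d \<longrightarrow>
        chi xs \<in> carrier H \<and>
        (\<not> distinct xs \<longrightarrow> chi xs = hzero H) \<and>
        (\<forall>\<pi>. \<pi> permutes {..<d} \<longrightarrow>
           chi (permute_list \<pi> xs) = hsign H (sign \<pi>) \<otimes>\<^bsub>H\<^esub> chi xs))"

text \<open>In the three-term Grassmann-Pluecker relation the set \<open>X\<close> is listed in an arbitrary order,
  the same in all six factors. The relation is void for \<open>d < 2\<close>.\<close>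

definition weak_matroid ::
  "('a, 'm) hyperstruct_scheme \<Rightarrow> nat \<Rightarrow> ('e::{finite,linorder} list \<Rightarrow> 'a) \<Rightarrow> bool" where
  "weak_matroid H d chi \<longleftrightarrow>
     alternating H d chi \<and>
     (\<exists>xs. length xs = d \<and> chi xs \<noteq> hzero H) \<and>
     matroid_bases {\<sigma>. card \<sigma> = d \<and> chi (sorted_list_of_set \<sigma>) \<noteq> hzero H} \<and>
     (\<forall>x1 x2 y1 y2 X. length X + 2 = d \<longrightarrow>
        hzero H \<in> hadd3 H
          (chi (x1 # x2 # X) \<otimes>\<^bsub>H\<^esub> chi (y1 # y2 # X))
          (chi (x1 # y1 # X) \<otimes>\<^bsub>H\<^esub> chi (y2 # x2 # X))
          (chi (x1 # y2 # X) \<otimes>\<^bsub>H\<^esub> chi (x2 # y1 # X)))"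


section \<open>Polyhedral matching fields\<close>

text \<open>The totally ordered finite sets \<open>R\<close> and \<open>E\<close> are types \<open>'r\<close> and \<open>'e\<close> of class
  \<open>finite\<close> and \<open>linorder\<close>, so that \<open>d = CARD('r)\<close> and \<open>n = CARD('e)\<close>.\<close>

definition standard_simplex :: "(real^'k) set" where
  "standard_simplex = convex hull (range (\<lambda>i. axis i 1))"

definition product_vertex :: "'r \<times> 'e \<Rightarrow> (real^'r) \<times> (real^'e)" where
  "product_vertex e = (axis (fst e) 1, axis (snd e) 1)"

text \<open>The library's \<open>triangulation\<close> gives finitely many simplices, any two of which meet in
  a common (possibly empty) face. The product of the two standard simplices has dimension
  \<open>(d - 1) + (n - 1)\<close>, and the vertices of a simplex are its extreme points.\<close>

definition product_triangulation :: "((real^'r) \<times> (real^'e)) set set \<Rightarrow> bool" where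
  "product_triangulation \<T> \<longleftrightarrow>
     triangulation \<T> \<and>
     \<Union>\<T> = standard_simplex \<times> standard_simplex \<and>
     (\<forall>S\<in>\<T>. (int CARD('r) + int CARD('e) - 2) simplex S \<and>
            {v. v extreme_point_of S} \<subseteq> range product_vertex)"

definition simplex_tree :: "((real^'r) \<times> (real^'e)) set \<Rightarrow> ('r \<times> 'e) set" where
  "simplex_tree S = {e. product_vertex e extreme_point_of S}"

definition perfect_matching :: "('r \<times> 'e) set \<Rightarrow> 'e set \<Rightarrow> bool" where
  "perfect_matching M \<sigma> \<longleftrightarrow>
     M \<subseteq> UNIV \<times> \<sigma> \<and> (\<forall>r. \<exists>!e. (r, e) \<in> M) \<and> (\<forall>e\<in>\<sigma>. \<exists>!r. (r, e) \<in> M)"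

text \<open>For each \<open>\<sigma>\<close> there is exactly one perfect matching contained in one of the trees, so that
  a triangulation determines \<open>M\<close> on the \<open>d\<close>-subsets.\<close>

definition polyhedral_matching_field :: "('e::finite set \<Rightarrow> ('r::finite \<times> 'e) set) \<Rightarrow> bool" where
  "polyhedral_matching_field M \<longleftrightarrow>
     (\<exists>\<T>. product_triangulation \<T> \<and>
        (\<forall>\<sigma>. card \<sigma> = CARD('r) \<longrightarrow>
           perfect_matching (M \<sigma>) \<sigma> \<and> (\<exists>S\<in>\<T>. M \<sigma> \<subseteq> simplex_tree S)))"

text \<open>The permutation \<open>[d] \<rightarrow> R \<rightarrow> \<sigma> \<rightarrow> [d]\<close>, with \<open>[d]\<close> shifted to \<open>{0, \<dots>, d - 1}\<close>.\<close>

definition matching_perm :: "'e::linorder set \<Rightarrow> ('r::{finite,linorder} \<times> 'e) set \<Rightarrow> nat \<Rightarrow> nat" where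
  "matching_perm \<sigma> M k =
     (if k < CARD('r)
      then (THE l. l < card \<sigma> \<and>
              (sorted_list_of_set (UNIV :: 'r set) ! k, sorted_list_of_set \<sigma> ! l) \<in> M)
      else k)"

definition matching_sign :: "'e::linorder set \<Rightarrow> ('r::{finite,linorder} \<times> 'e) set \<Rightarrow> int" where
  "matching_sign \<sigma> M = sign (matching_perm \<sigma> M)"

end

theory Submission
  imports Defs
begin

text \<open>All \<open>d\<close>-subsets are bases, so only the three-term relations matter, and in both hyperfields such a
  relation holds as soon as two of its three terms are opposite. For distinct \<open>x1, x2, y1, y2\<close> outside
  \<open>X\<close>, take the point of the product of simplices whose coordinates are proportional to \<open>2\<close> on \<open>R\<close> and
  on \<open>X\<close> and to \<open>1\<close> on the four elements. Its coordinates in a simplex of the triangulation that contains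
  it are integral because the simplex is a tree, and they form a bipartite multigraph that is the
  union of two matchings. An alternating path of this multigraph joins two of the four elements, and
  swapping the matchings along it gives a second pair of matchings with the same union. Two
  matchings of the same set in simplices of the triangulation coincide, so all four belong to the
  field, and the swap does not change the product of the signs.\<close>

section \<open>Trees and integral weights\<close>

text \<open>The three terms of the relation belong to the three ways of splitting the four elements
  into two pairs, each pair being completed by \<open>X\<close>. The path that starts at
  \<open>x1\<close> ends at an element of the other pair, so the swap passes from one splitting to
  another; with the order of arguments in the relation, the two equal products become opposite
  terms. Nothing is known about the third term. Over \<open>H\<close> itself the sum may therefore
  miss zero, and this is where \<open>u \<boxplus> -u\<close> has to be the whole carrier. The
  argument accordingly takes place over \<open>H\<close> and proves only the condition
  \<open>cancelling\<close>, which speaks of zero and negatives and hence passes through morphisms.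
  A second obstacle is that the integral weights give each row two edges without saying which of
  them belongs to which matching, so the edges must be distributed over two injective maps.\<close>

lemma inj_product_vertex: "inj product_vertex"
  by (auto simp: inj_def product_vertex_def axis_eq_axis)

lemma sum_axis_nth:
  fixes c :: "'a::finite \<Rightarrow> real"
  shows "(\<Sum>a\<in>UNIV. c a *\<^sub>R (axis a 1 :: real^'a)) = (\<chi> a. c a)"
  by (simp add: vec_eq_iff axis_def if_distrib cong: if_cong)

text \<open>The dictionary between geometry and graphs: relations between vertices of the product
  become conditions on the weighted degrees of rows (elements of \<open>'r\<close>) and columns
  (elements of \<open>'e\<close>).\<close>

lemma sum_product_vertex:
  fixes c :: "'r::finite \<times> 'e::finite \<Rightarrow> real"
  shows "(\<Sum>x\<in>UNIV. c x *\<^sub>R product_vertex x) =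
    ((\<chi> r. \<Sum>e\<in>UNIV. c (r, e)), (\<chi> e. \<Sum>r\<in>UNIV. c (r, e)))"
proof (rule prod_eqI)
  have "fst (\<Sum>x\<in>UNIV. c x *\<^sub>R product_vertex x) =
      (\<Sum>r\<in>UNIV. \<Sum>e\<in>UNIV. c (r, e) *\<^sub>R (axis r 1 :: real^'r))"
    by (simp add: fst_sum product_vertex_def sum.cartesian_product case_prod_beta flip: UNIV_Times_UNIV)
  also have "\<dots> = (\<Sum>r\<in>UNIV. (\<Sum>e\<in>UNIV. c (r, e)) *\<^sub>R axis r 1)"
    by (simp add: scaleR_left.sum)
  finally show "fst (\<Sum>x\<in>UNIV. c x *\<^sub>R product_vertex x) =
      fst ((\<chi> r. \<Sum>e\<in>UNIV. c (r, e)), (\<chi> e. \<Sum>r\<in>UNIV. c (r, e)) :: real^'e)"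
    by (simp only: sum_axis_nth fst_conv)
  have "snd (\<Sum>x\<in>UNIV. c x *\<^sub>R product_vertex x) =
      (\<Sum>r\<in>UNIV. \<Sum>e\<in>UNIV. c (r, e) *\<^sub>R (axis e 1 :: real^'e))"
    by (simp add: snd_sum product_vertex_def sum.cartesian_product case_prod_beta flip: UNIV_Times_UNIV)
  also have "\<dots> = (\<Sum>e\<in>UNIV. \<Sum>r\<in>UNIV. c (r, e) *\<^sub>R axis e 1)"
    by (rule sum.swap)
  also have "\<dots> = (\<Sum>e\<in>UNIV. (\<Sum>r\<in>UNIV. c (r, e)) *\<^sub>R axis e 1)"
    by (simp add: scaleR_left.sum)
  finally show "snd (\<Sum>x\<in>UNIV. c x *\<^sub>R product_vertex x) =
      snd ((\<chi> r. \<Sum>e\<in>UNIV. c (r, e)) :: real^'r, (\<chi> e. \<Sum>r\<in>UNIV. c (r, e)))"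
    by (simp only: sum_axis_nth snd_conv)
qed

lemma sum_product_vertex_image:
  fixes U :: "(real^'r) \<times> (real^'e) \<Rightarrow> real" and T :: "('r::finite \<times> 'e::finite) set"
  shows "(\<Sum>v\<in>product_vertex ` T. U v *\<^sub>R v) =
    (\<Sum>x\<in>UNIV. (if x \<in> T then U (product_vertex x) else 0) *\<^sub>R product_vertex x)"
proof -
  have "(\<Sum>v\<in>product_vertex ` T. U v *\<^sub>R v) = (\<Sum>x\<in>T. U (product_vertex x) *\<^sub>R product_vertex x)"
    by (subst sum.reindex) (auto intro: inj_on_subset[OF inj_product_vertex])
  also have "\<dots> = (\<Sum>x\<in>UNIV. (if x \<in> T then U (product_vertex x) else 0) *\<^sub>R product_vertex x)"
    by (rule sum.mono_neutral_cong_left) auto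
  finally show ?thesis .
qed

text \<open>Acyclicity of the edge set \<open>T\<close> in linear-algebraic form.\<close>

definition edge_independent :: "('r::finite \<times> 'e::finite) set \<Rightarrow> bool" where
  "edge_independent T \<longleftrightarrow>
    (\<forall>D :: 'r \<times> 'e \<Rightarrow> real. (\<forall>x. x \<notin> T \<longrightarrow> D x = 0) \<longrightarrow> (\<forall>r. (\<Sum>e\<in>UNIV. D (r, e)) = 0) \<longrightarrow>
       (\<forall>e. (\<Sum>r\<in>UNIV. D (r, e)) = 0) \<longrightarrow> (\<forall>x. D x = 0))"

lemma edge_independentD:
  fixes w w' :: "'r::finite \<times> 'e::finite \<Rightarrow> real"
  assumes "edge_independent T" "\<And>x. x \<notin> T \<Longrightarrow> w x = 0" "\<And>x. x \<notin> T \<Longrightarrow> w' x = 0"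
    and "\<And>r. (\<Sum>e\<in>UNIV. w (r, e)) = (\<Sum>e\<in>UNIV. w' (r, e))"
    and "\<And>e. (\<Sum>r\<in>UNIV. w (r, e)) = (\<Sum>r\<in>UNIV. w' (r, e))"
  shows "w = w'"
proof -
  have "\<forall>x. w x - w' x = 0"
    using assms(1)[unfolded edge_independent_def, rule_format, of "\<lambda>x. w x - w' x"] assms(2-)
    by (simp add: sum_subtractf)
  then show ?thesis by auto
qed

lemma edge_independent_if_affine_independent:
  assumes "\<not> affine_dependent (product_vertex ` T)"
  shows "edge_independent T"
  unfolding edge_independent_def
proof (intro allI impI)
  fix D :: "'a \<times> 'b \<Rightarrow> real" and x
  assume D: "\<forall>x. x \<notin> T \<longrightarrow> D x = 0" "\<forall>r. (\<Sum>e\<in>UNIV. D (r, e)) = 0" "\<forall>e. (\<Sum>r\<in>UNIV. D (r, e)) = 0"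
  define U where "U = D \<circ> inv_into UNIV product_vertex"
  have U: "U (product_vertex x) = D x" for x
    by (simp add: U_def inj_product_vertex)
  have "(\<Sum>v\<in>product_vertex ` T. U v *\<^sub>R v) = (\<Sum>x\<in>UNIV. D x *\<^sub>R product_vertex x)"
    unfolding sum_product_vertex_image using D(1) by (intro sum.cong) (auto simp: U)
  also have "\<dots> = 0"
    using D(2,3) by (simp add: sum_product_vertex zero_prod_def vec_eq_iff)
  finally have 0: "(\<Sum>v\<in>product_vertex ` T. U v *\<^sub>R v) = 0" .
  \<comment> \<open>The total weight is the sum of the row sums and so vanishes: the linear relation
    is an affine one.\<close>
  have "sum U (product_vertex ` T) = sum D T"
    by (subst sum.reindex) (auto simp: U intro: inj_on_subset[OF inj_product_vertex])
  also have "\<dots> = sum D UNIV"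
    using D(1) by (intro sum.mono_neutral_left) auto
  also have "\<dots> = (\<Sum>r\<in>UNIV. \<Sum>e\<in>UNIV. D (r, e))"
    by (simp add: sum.cartesian_product)
  also have "\<dots> = 0" using D(2) by simp
  finally have "\<forall>v\<in>product_vertex ` T. U v = 0"
    using assms 0 affine_dependent_explicit_finite[of "product_vertex ` T"] by auto
  then show "D x = 0" using D(1)[rule_format, of x] by (cases "x \<in> T") (simp_all add: U)
qed

text \<open>Linear independence, because \<open>integral_weights\<close> compares the number of
  edges with the size of a spanning set.\<close>

lemma independent_product_vertex:
  assumes "edge_independent T" "N \<subseteq> T"
  shows "independent (product_vertex ` N)"
proof
  assume "dependent (product_vertex ` N)"
  then obtain U where U: "\<exists>v\<in>product_vertex ` N. U v \<noteq> 0" "(\<Sum>v\<in>product_vertex ` N. U v *\<^sub>R v) = 0"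
    by (auto simp: real_vector.dependent_finite)
  define D where "D x = (if x \<in> N then U (product_vertex x) else 0)" for x
  have "(\<Sum>x\<in>UNIV. D x *\<^sub>R product_vertex x) = 0"
    using U(2) unfolding sum_product_vertex_image D_def .
  then have "D = (\<lambda>x. 0)"
    using assms(2)
    by (intro edge_independentD[OF assms(1)]) (auto simp: sum_product_vertex zero_prod_def vec_eq_iff D_def)
  then have "U (product_vertex x) = 0" if "x \<in> N" for x
    using that by (auto simp: D_def dest: fun_cong[of _ _ x])
  with U(1) show False by auto
qed

lemma card_insert_le_Suc: "card (insert x A) \<le> Suc (card A)"
  by (cases "finite A") (auto simp: card_insert_if)

text \<open>Every fibre over the image has at least two elements. For \<open>h = fst\<close> and
  \<open>h = snd\<close> this is the edge count of a bipartite graph without leaves.\<close>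

lemma card_ge_two_mul_card_image:
  assumes "finite N" "\<And>x. x \<in> N \<Longrightarrow> \<exists>y\<in>N. y \<noteq> x \<and> h y = h x"
  shows "2 * card (h ` N) \<le> card N"
proof -
  have "2 \<le> card {x \<in> N. h x = c}" if c: "c \<in> h ` N" for c
  proof -
    obtain x where x: "x \<in> N" "h x = c" using c by auto
    obtain y where "y \<in> N" "y \<noteq> x" "h y = c" using assms(2)[of x] x by auto
    then have "card {x, y} \<le> card {x \<in> N. h x = c}"
      using x assms(1) by (intro card_mono) auto
    then show ?thesis using \<open>y \<noteq> x\<close> by simp
  qed
  then have "(\<Sum>c\<in>h ` N. 2) \<le> (\<Sum>c\<in>h ` N. card {x \<in> N. h x = c})"
    by (rule sum_mono)
  also have "\<dots> = card N"
    using sum.image_gen[OF assms(1), of "\<lambda>_. 1 :: nat" h] by simp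
  finally show ?thesis by simp
qed

lemma exists_other_nonint:
  fixes w :: "'a::finite \<Rightarrow> real"
  assumes "(\<Sum>a\<in>UNIV. w a) \<in> \<int>" "w a \<notin> \<int>"
  shows "\<exists>b. b \<noteq> a \<and> w b \<notin> \<int>"
proof (rule ccontr)
  assume "\<not> ?thesis"
  then have "(\<Sum>b\<in>UNIV - {a}. w b) \<in> \<int>" by (auto intro: Ints_sum)
  moreover have "(\<Sum>a\<in>UNIV. w a) = w a + (\<Sum>b\<in>UNIV - {a}. w b)"
    by (simp add: sum.remove)
  ultimately show False
    using assms by (metis Ints_diff add_diff_cancel_right')
qed

text \<open>The edges of non-integral weight form a graph without leaves, hence with at least as many
  edges as vertices, and this contradicts acyclicity.\<close>

lemma integral_weights:
  fixes w :: "'r::finite \<times> 'e::finite \<Rightarrow> real"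
  assumes T: "edge_independent T" and w: "\<And>x. x \<notin> T \<Longrightarrow> w x = 0"
    and row: "\<And>r. (\<Sum>e\<in>UNIV. w (r, e)) \<in> \<int>" and col: "\<And>e. (\<Sum>r\<in>UNIV. w (r, e)) \<in> \<int>"
  shows "w x \<in> \<int>"
proof (rule ccontr)
  assume x: "w x \<notin> \<int>"
  define N where "N = {x. w x \<notin> \<int>}"
  define r0 where "r0 = fst x"
  define e0 where "e0 = snd x"
  have x0: "(r0, e0) \<in> N" using x by (simp add: N_def r0_def e0_def)
  have "N \<subseteq> T" using w by (force simp: N_def)
  have "2 * card (fst ` N) \<le> card N"
  proof (rule card_ge_two_mul_card_image)
    fix y assume "y \<in> N"
    then obtain b where "b \<noteq> snd y" "w (fst y, b) \<notin> \<int>"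
      using exists_other_nonint[OF row[of "fst y"], of "snd y"] by (auto simp: N_def)
    then show "\<exists>z\<in>N. z \<noteq> y \<and> fst z = fst y"
      by (intro bexI[of _ "(fst y, b)"]) (auto simp: N_def prod_eq_iff)
  qed simp
  moreover have "2 * card (snd ` N) \<le> card N"
  proof (rule card_ge_two_mul_card_image)
    fix y assume "y \<in> N"
    then obtain b where "b \<noteq> fst y" "w (b, snd y) \<notin> \<int>"
      using exists_other_nonint[OF col[of "snd y"], of "fst y"] by (auto simp: N_def)
    then show "\<exists>z\<in>N. z \<noteq> y \<and> snd z = snd y"
      by (intro bexI[of _ "(b, snd y)"]) (auto simp: N_def prod_eq_iff)
  qed simp
  \<comment> \<open>\<open>B\<close> is the double star centred at the edge \<open>(r0, e0)\<close>,
    a spanning tree on the rows and columns that meet \<open>N\<close>. It bounds the number of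
    edges by rows plus columns minus one, whereas the two degree counts bound it below by rows plus
    columns.\<close>
  moreover define B :: "((real^'r) \<times> (real^'e)) set"
    where "B = insert (product_vertex (r0, e0)) ((\<lambda>e. product_vertex (r0, e)) ` (snd ` N - {e0}) \<union>
           (\<lambda>r. product_vertex (r, e0)) ` (fst ` N - {r0}))"
  have B: "product_vertex (r0, e) \<in> B" "product_vertex (r, e0) \<in> B" if "(r, e) \<in> N" for r e
    using that by (force simp: B_def)+
  have "product_vertex ` N \<subseteq> span B"
  proof
    fix v :: "(real^'r) \<times> (real^'e)" assume "v \<in> product_vertex ` N"
    then obtain r e where re: "(r, e) \<in> N" and v: "v = product_vertex (r, e)" by auto
    have "product_vertex (r, e) =
        product_vertex (r, e0) + product_vertex (r0, e) - product_vertex (r0, e0)"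
      by (simp add: product_vertex_def)
    then show "v \<in> span B"
      using v B[OF re] B[OF x0] by (simp add: span_add span_diff span_base)
  qed
  then have "card (product_vertex ` N) \<le> card B"
    using real_vector.independent_span_bound[OF _ independent_product_vertex[OF T \<open>N \<subseteq> T\<close>]]
    by (auto simp: B_def)
  moreover have "card (product_vertex ` N) = card N"
    by (intro card_image inj_on_subset[OF inj_product_vertex]) auto
  moreover have "card B \<le> Suc (card (snd ` N - {e0}) + card (fst ` N - {r0}))"
  proof -
    have "card B \<le> Suc (card ((\<lambda>e. product_vertex (r0, e) :: (real^'r) \<times> (real^'e)) ` (snd ` N - {e0}) \<union>
        (\<lambda>r. product_vertex (r, e0)) ` (fst ` N - {r0})))"
      unfolding B_def by (rule card_insert_le_Suc)
    also have "\<dots> \<le> Suc (card ((\<lambda>e. product_vertex (r0, e) :: (real^'r) \<times> (real^'e)) ` (snd ` N - {e0})) +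
        card ((\<lambda>r. product_vertex (r, e0) :: (real^'r) \<times> (real^'e)) ` (fst ` N - {r0})))"
      by (simp add: card_Un_le)
    also have "\<dots> \<le> Suc (card (snd ` N - {e0}) + card (fst ` N - {r0}))"
      by (intro iffD2[OF Suc_le_mono] add_mono card_image_le) simp_all
    finally show ?thesis .
  qed
  moreover have "card (snd ` N) > 0" "card (fst ` N) > 0"
    using x0 by (auto simp: card_gt_0_iff)
  moreover have "card (snd ` N - {e0}) = card (snd ` N) - 1" "card (fst ` N - {r0}) = card (fst ` N) - 1"
    using image_eqI[OF _ x0, of _ snd] image_eqI[OF _ x0, of _ fst] by (simp_all add: card_Diff_singleton)
  ultimately show False by linarith
qed

section \<open>Matchings in a triangulation\<close>

text \<open>A simplex comes with some affinely independent generating set. Its members are exactly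
  the extreme points, and these are vertices of the product, so the set is the image of the
  tree.\<close>

lemma simplex_eq_convex_hull_tree:
  assumes "product_triangulation \<T>" "S \<in> \<T>"
  shows "\<not> affine_dependent (product_vertex ` simplex_tree S)"
    and "S = convex hull (product_vertex ` simplex_tree S)"
proof -
  obtain C where C: "\<not> affine_dependent C" "S = convex hull C"
    using assms unfolding product_triangulation_def simplex_def by meson
  have ext: "v extreme_point_of S \<longleftrightarrow> v \<in> C" for v
    using extreme_point_of_convex_hull_affine_independent[OF C(1)] C(2) by simp
  then have "C \<subseteq> range product_vertex"
    using assms unfolding product_triangulation_def by blast
  then have "product_vertex ` simplex_tree S = C"
    by (auto simp: simplex_tree_def ext)
  with C show "\<not> affine_dependent (product_vertex ` simplex_tree S)"
    and "S = convex hull (product_vertex ` simplex_tree S)" by simp_all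
qed

lemma mem_standard_simplex:
  fixes u :: "real^'k"
  assumes "\<And>k. 0 \<le> u $ k" "(\<Sum>k\<in>UNIV. u $ k) = 1"
  shows "u \<in> standard_simplex"
proof -
  have "(\<Sum>k\<in>UNIV. u $ k *\<^sub>R (axis k 1 :: real^'k)) \<in> standard_simplex"
    unfolding standard_simplex_def using assms by (intro convex_sum) (auto intro: hull_inc)
  then show ?thesis by (simp add: sum_axis_nth)
qed

lemma sum_of_bool_eq_one:
  fixes P :: "'a::finite \<Rightarrow> bool"
  assumes "\<exists>!a. P a"
  shows "(\<Sum>a\<in>UNIV. of_bool (P a)) = (1 :: 'b::semiring_1)"
proof -
  obtain a where "P a" "\<And>b. P b \<Longrightarrow> b = a" using assms by blast
  then have "P b \<longleftrightarrow> b = a" for b by blast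
  then show ?thesis by (simp add: of_bool_def)
qed

text \<open>The margins of a matching depend on \<open>\<sigma>\<close> alone. This makes two
  matchings of the same set comparable, both through their barycentres and through
  \<open>edge_independentD\<close>.\<close>

lemma perfect_matching_sums:
  fixes Q :: "('r::finite \<times> 'e::finite) set"
  assumes "perfect_matching Q \<sigma>"
  shows "(\<Sum>e\<in>UNIV. of_bool ((r, e) \<in> Q)) = (1 :: real)"
    and "(\<Sum>r\<in>UNIV. of_bool ((r, e) \<in> Q)) = (of_bool (e \<in> \<sigma>) :: real)"
proof -
  show "(\<Sum>e\<in>UNIV. of_bool ((r, e) \<in> Q)) = (1 :: real)"
    using assms by (intro sum_of_bool_eq_one) (auto simp: perfect_matching_def)
  show "(\<Sum>r\<in>UNIV. of_bool ((r, e) \<in> Q)) = (of_bool (e \<in> \<sigma>) :: real)"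
  proof (cases "e \<in> \<sigma>")
    case True
    then show ?thesis
      using assms by (subst sum_of_bool_eq_one) (auto simp: perfect_matching_def)
  next
    case False
    then have "(r, e) \<notin> Q" for r using assms by (auto simp: perfect_matching_def)
    then show ?thesis using False by simp
  qed
qed

lemma card_perfect_matching:
  fixes Q :: "('r::finite \<times> 'e::finite) set"
  assumes "perfect_matching Q \<sigma>"
  shows "card Q = CARD('r)"
proof -
  have "real (card Q) = (\<Sum>x\<in>UNIV. of_bool (x \<in> Q))" by simp
  also have "\<dots> = (\<Sum>r\<in>UNIV. \<Sum>e\<in>UNIV. of_bool ((r, e) \<in> Q))"
    by (simp add: sum.cartesian_product del: sum_of_bool_eq)
  also have "\<dots> = real CARD('r)"
    by (simp only: perfect_matching_sums(1)[OF assms]) simp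
  finally show ?thesis by simp
qed

text \<open>A matching has \<open>CARD('r)\<close> edges; the equal coefficients
  \<open>1 / CARD('r)\<close> sum to one and are all positive, which characterises the relative
  interior.\<close>

lemma barycenter_in_rel_interior:
  fixes Q :: "('r::finite \<times> 'e::finite) set"
  assumes "perfect_matching Q \<sigma>" "\<not> affine_dependent (product_vertex ` Q)"
  shows "((\<chi> r. 1 / CARD('r)), (\<chi> e. of_bool (e \<in> \<sigma>) / CARD('r)))
    \<in> rel_interior (convex hull (product_vertex ` Q))"
proof -
  let ?c = "1 / real CARD('r)"
  have "(\<Sum>v\<in>product_vertex ` Q. ?c *\<^sub>R v) =
      (\<Sum>x\<in>UNIV. (?c * of_bool (x \<in> Q)) *\<^sub>R product_vertex x)"
    unfolding sum_product_vertex_image by (rule sum.cong) auto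
  also have "\<dots> = ((\<chi> r. 1 / CARD('r)), (\<chi> e. of_bool (e \<in> \<sigma>) / CARD('r)))"
    unfolding sum_product_vertex sum_distrib_left[symmetric] perfect_matching_sums[OF assms(1)] by simp
  finally have "(\<Sum>v\<in>product_vertex ` Q. ?c *\<^sub>R v) =
      ((\<chi> r. 1 / CARD('r)), (\<chi> e. of_bool (e \<in> \<sigma>) / CARD('r)))" .
  moreover have "card (product_vertex ` Q) = CARD('r)"
    using card_perfect_matching[OF assms(1)]
    by (simp add: card_image inj_on_subset[OF inj_product_vertex])
  ultimately show ?thesis
    unfolding rel_interior_convex_hull_explicit[OF assms(2)]
    by (intro CollectI exI[of _ "\<lambda>_. ?c"]) auto
qed

text \<open>Both matchings have the same barycentre, so the common face of the two simplices contains
  it, and a face that meets the relative interior of a simplex contains that simplex.\<close>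

lemma perfect_matching_unique:
  fixes \<T> :: "((real^'r::finite) \<times> (real^'e::finite)) set set"
  assumes tri: "product_triangulation \<T>" and S: "S \<in> \<T>" "S' \<in> \<T>"
    and Q: "perfect_matching Q \<sigma>" "Q \<subseteq> simplex_tree S"
    and Q': "perfect_matching Q' \<sigma>" "Q' \<subseteq> simplex_tree S'"
  shows "Q = Q'"
proof -
  let ?p = "((\<chi> r. 1 / CARD('r)), (\<chi> e. of_bool (e \<in> \<sigma>) / CARD('r))) :: (real^'r) \<times> (real^'e)"
  note hull = simplex_eq_convex_hull_tree[OF tri]
  have sub: "convex hull (product_vertex ` P) \<subseteq> T \<and>
      ?p \<in> rel_interior (convex hull (product_vertex ` P)) \<and>
      ?p \<in> T"
    if "T \<in> \<T>" "P \<subseteq> simplex_tree T" "perfect_matching P \<sigma>" for P T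
  proof -
    have "\<not> affine_dependent (product_vertex ` P)"
      using hull(1)[OF that(1)] that(2) by (meson affine_dependent_subset image_mono)
    then have "?p \<in> rel_interior (convex hull (product_vertex ` P))"
      using barycenter_in_rel_interior[OF that(3)] by blast
    moreover have "convex hull (product_vertex ` P) \<subseteq> convex hull (product_vertex ` simplex_tree T)"
      using that(2) by (intro hull_mono image_mono)
    ultimately show ?thesis
      using rel_interior_subset hull(2)[OF that(1)] by blast
  qed
  have face: "S \<inter> S' face_of S" "S \<inter> S' face_of S'"
  proof -
    have "triangulation \<T>" using tri by (simp add: product_triangulation_def)
    then show "S \<inter> S' face_of S" "S \<inter> S' face_of S'"
      using S by (simp_all add: triangulation_def) (metis Int_commute)
  qed
  have "convex hull (product_vertex ` Q) \<subseteq> S \<inter> S'"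
    using sub[OF S(1) Q(2,1)] sub[OF S(2) Q'(2,1)] by (intro subset_of_face_of[OF face(1)]) auto
  then have "product_vertex x \<in> S \<inter> S'" if "x \<in> Q" for x
    using that by (meson hull_inc image_eqI subsetD)
  then have "Q \<subseteq> simplex_tree S'"
    using Q(2) extreme_point_of_face[OF face(1)] extreme_point_of_face[OF face(2)]
    unfolding simplex_tree_def by blast
  \<comment> \<open>Both matchings now lie in the single tree of \<open>S'\<close> and have equal
    margins, so acyclicity identifies them.\<close>
  then have "(\<lambda>x. of_bool (x \<in> Q) :: real) = (\<lambda>x. of_bool (x \<in> Q'))"
    using Q' edge_independent_if_affine_independent[OF hull(1)[OF S(2)]]
    by (intro edge_independentD[of "simplex_tree S'"])
      (auto simp: perfect_matching_sums[OF Q(1)] perfect_matching_sums[OF Q'(1)] simp del: sum_of_bool_eq)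
  then have "x \<in> Q \<longleftrightarrow> x \<in> Q'" for x
    by (metis of_bool_eq_iff)
  then show ?thesis by blast
qed

section \<open>Matchings read off from an integral point of the product\<close>

definition graph_of :: "('r \<Rightarrow> 'e) \<Rightarrow> ('r \<times> 'e) set" where
  "graph_of f = range (\<lambda>r. (r, f r))"

lemma perfect_matching_graph_of:
  assumes "inj f"
  shows "perfect_matching (graph_of f) (range f)"
  using assms by (auto simp: perfect_matching_def graph_of_def inj_def)

text \<open>The simplex is one that contains the point with coordinates proportional to the margins.\<close>

lemma matching_field_integral_flow:
  fixes M :: "'e::finite set \<Rightarrow> ('r::finite \<times> 'e) set" and a :: "'r \<Rightarrow> nat" and b :: "'e \<Rightarrow> nat"
  assumes M: "polyhedral_matching_field M"
    and ab: "sum a UNIV = sum b UNIV" "sum a UNIV > 0"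
  obtains w :: "'r \<times> 'e \<Rightarrow> nat"
  where "\<And>r. (\<Sum>e\<in>UNIV. w (r, e)) = a r" "\<And>e. (\<Sum>r\<in>UNIV. w (r, e)) = b e"
    "\<And>f. inj f \<Longrightarrow> (\<And>r. 0 < w (r, f r)) \<Longrightarrow> M (range f) = graph_of f"
proof -
  obtain \<T> where tri: "product_triangulation \<T>"
    and MT: "\<And>\<sigma>. card \<sigma> = CARD('r) \<Longrightarrow> perfect_matching (M \<sigma>) \<sigma> \<and> (\<exists>S\<in>\<T>. M \<sigma> \<subseteq> simplex_tree S)"
    using M unfolding polyhedral_matching_field_def by blast
  define N where "N = real (sum a UNIV)"
  have N: "N > 0" "(\<Sum>r\<in>UNIV. real (a r)) = N" "(\<Sum>e\<in>UNIV. real (b e)) = N"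
    using ab by (simp_all add: N_def del: of_nat_sum flip: of_nat_sum)
  let ?p = "((\<chi> r. a r / N), (\<chi> e. b e / N))"
  have "?p \<in> standard_simplex \<times> standard_simplex"
    using N by (auto intro!: mem_standard_simplex simp flip: sum_divide_distrib)
  then have "?p \<in> \<Union>\<T>"
    using tri by (simp add: product_triangulation_def)
  then obtain S where S: "S \<in> \<T>" "?p \<in> S" by blast
  define T where "T = simplex_tree S"
  have indep: "edge_independent T"
    unfolding T_def by (rule edge_independent_if_affine_independent[OF simplex_eq_convex_hull_tree(1)[OF tri S(1)]])
  have "?p \<in> convex hull (product_vertex ` T)"
    using simplex_eq_convex_hull_tree(2)[OF tri S(1)] S(2) by (simp add: T_def)
  then obtain U where U: "\<forall>v\<in>product_vertex ` T. 0 \<le> U v" "(\<Sum>v\<in>product_vertex ` T. U v *\<^sub>R v) = ?p"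
    by (auto simp: convex_hull_finite)
  \<comment> \<open>Barycentric coordinates in \<open>S\<close>, extended by zero off the tree. The
    factor \<open>N\<close> undoes the normalisation of \<open>?p\<close>, so the margins are the
    integers \<open>a\<close> and \<open>b\<close>.\<close>
  define w where "w x = N * (if x \<in> T then U (product_vertex x) else 0)" for x
  have w0: "0 \<le> w x" "x \<notin> T \<Longrightarrow> w x = 0" for x
    using U(1) N(1) by (auto simp: w_def)
  have "(\<Sum>x\<in>UNIV. (if x \<in> T then U (product_vertex x) else 0) *\<^sub>R product_vertex x) = ?p"
    using U(2) by (simp only: sum_product_vertex_image)
  then have "(\<Sum>e\<in>UNIV. if (r, e) \<in> T then U (product_vertex (r, e)) else 0) = a r / N"
    "(\<Sum>r\<in>UNIV. if (r, e) \<in> T then U (product_vertex (r, e)) else 0) = b e / N" for r e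
    unfolding sum_product_vertex by (simp_all add: vec_eq_iff)
  then have ws: "(\<Sum>e\<in>UNIV. w (r, e)) = a r" "(\<Sum>r\<in>UNIV. w (r, e)) = b e" for r e
    using N(1) by (simp_all add: w_def flip: sum_distrib_left)
  have "w x \<in> \<int>" for x
    by (rule integral_weights[OF indep w0(2)]) (simp_all add: ws)
  then have "\<exists>k. w x = real k" for x
    using w0(1)[of x] by (metis Ints_cases of_int_0_le_iff of_int_of_nat_eq zero_le_imp_eq_int)
  then obtain W where W: "\<And>x. w x = real (W x)" by metis
  show ?thesis
  proof
    show "(\<Sum>e\<in>UNIV. W (r, e)) = a r" for r
      using ws(1)[of r] by (simp add: W flip: of_nat_sum)
    show "(\<Sum>r\<in>UNIV. W (r, e)) = b e" for e
      using ws(2)[of e] by (simp add: W flip: of_nat_sum)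
    fix f :: "'r \<Rightarrow> 'e" assume f: "inj f" "\<And>r. 0 < W (r, f r)"
    \<comment> \<open>Edges of positive weight belong to the tree of \<open>S\<close>, so every
      matching composed of them is the one of the field by uniqueness.\<close>
    have "(r, f r) \<in> T" for r
      using f(2)[of r] w0(2)[of "(r, f r)"] by (auto simp: W)
    then have "graph_of f \<subseteq> simplex_tree S" by (auto simp: graph_of_def T_def)
    moreover have "card (range f) = CARD('r)" using f(1) by (rule card_image)
    ultimately show "M (range f) = graph_of f"
      using MT perfect_matching_unique[OF tri] perfect_matching_graph_of[OF f(1)] S(1) by meson
  qed
qed

section \<open>Alternating paths\<close>

definition swap_on :: "'r set \<Rightarrow> ('r \<Rightarrow> 'e) \<Rightarrow> ('r \<Rightarrow> 'e) \<Rightarrow> 'r \<Rightarrow> 'e" where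
  "swap_on P f g r = (if r \<in> P then g r else f r)"

text \<open>Only the rows are recorded. A step leaves the row \<open>x\<close> by its
  \<open>g\<close>-edge and enters \<open>y\<close> by the \<open>f\<close>-edge at the same column,
  so the path leads away from the column \<open>f s\<close>.\<close>

definition alternating_path :: "('r \<Rightarrow> 'e) \<Rightarrow> ('r \<Rightarrow> 'e) \<Rightarrow> 'r \<Rightarrow> 'r set" where
  "alternating_path f g s = {p. (s, p) \<in> {(x, y). g x = f y}\<^sup>*}"

lemma alternating_path_start: "s \<in> alternating_path f g s"
  by (simp add: alternating_path_def)

lemma alternating_path_step:
  "p \<in> alternating_path f g s \<Longrightarrow> g p = f q \<Longrightarrow> q \<in> alternating_path f g s"
  by (auto simp: alternating_path_def intro: rtrancl_into_rtrancl)

lemma alternating_path_pred: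
  assumes "p \<in> alternating_path f g s"
  shows "p = s \<or> (\<exists>q\<in>alternating_path f g s. g q = f p)"
  using assms unfolding alternating_path_def by (auto elim: rtranclE)

section \<open>Splitting a bipartite multigraph of degree at most two into two matchings\<close>

definition total_degree :: "('r::finite \<Rightarrow> 'e) \<Rightarrow> ('r \<Rightarrow> 'e) \<Rightarrow> 'e \<Rightarrow> nat" where
  "total_degree f g e = (\<Sum>r\<in>UNIV. of_bool (f r = e) + of_bool (g r = e))"

lemma total_degree_eq: "total_degree f g e = card {r. f r = e} + card {r. g r = e}"
  by (simp add: total_degree_def sum.distrib)

lemma total_degree_commute: "total_degree f g = total_degree g f"
  by (simp add: total_degree_def add.commute fun_eq_iff)

lemma total_degree_swap_on:
  "total_degree (swap_on P f g) (swap_on P g f) = total_degree f g"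
  unfolding total_degree_def by (intro ext sum.cong) (auto simp: swap_on_def)

lemma total_degree_inj:
  assumes "inj f" "inj g"
  shows "total_degree f g e = of_bool (e \<in> range f) + of_bool (e \<in> range g)"
proof -
  have "(\<Sum>r\<in>UNIV. of_bool (h r = e)) = (of_bool (e \<in> range h) :: nat)" if "inj h" for h :: "'a \<Rightarrow> 'b"
  proof (cases "e \<in> range h")
    case True
    then have "\<exists>!r. h r = e" using that by (auto simp: inj_def)
    from sum_of_bool_eq_one[OF this, where 'b = nat] True show ?thesis by (simp del: sum_of_bool_eq)
  next
    case False
    then have "h r \<noteq> e" for r by auto
    then show ?thesis using False by simp
  qed
  then show ?thesis using assms by (simp add: total_degree_def sum.distrib del: sum_of_bool_eq)
qed

text \<open>The two \<open>f\<close>-edges at the column \<open>f r\<close> already exhaust the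
  degree bound.\<close>

lemma not_in_range_if_collision:
  assumes "total_degree f g (f r) \<le> 2" "r \<noteq> s" "f r = f s"
  shows "f r \<notin> range g"
proof
  assume "f r \<in> range g"
  then obtain t where t: "g t = f r" by (metis imageE)
  have "card {r, s} \<le> card {r'. f r' = f r}" "card {t} \<le> card {r'. g r' = f r}"
    using assms(3) t by (intro card_mono; simp)+
  then show False
    using assms(1,2) by (simp add: total_degree_eq)
qed

definition collisions :: "('r \<Rightarrow> 'e) \<Rightarrow> ('r \<Rightarrow> 'e) \<Rightarrow> ('r \<times> 'r) set" where
  "collisions f g = {(r, s). r \<noteq> s \<and> (f r = f s \<or> g r = g s)}"

text \<open>A new collision would join a row on the path with a row off it, through an
  \<open>f\<close>-edge of one and a \<open>g\<close>-edge of the other. If the row on the path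
  contributes its \<open>g\<close>-edge, the path continues to the other row. If it contributes its
  \<open>f\<close>-edge, the column is \<open>f s\<close>, which has no \<open>g\<close>-edge, or it
  already has a \<open>g\<close>-edge from the path, and the further edge exceeds degree two. The
  collision of \<open>r\<close> and \<open>s\<close> disappears because \<open>r\<close> is off the
  path.\<close>

lemma collisions_decrease:
  assumes deg: "\<And>e. total_degree f g e \<le> 2" and rs: "r \<noteq> s" "f r = f s"
  defines "P \<equiv> alternating_path f g s"
  shows "collisions (swap_on P f g) (swap_on P g f) \<subset> collisions f g"
proof -
  have e: "g t \<noteq> f s" for t
    using not_in_range_if_collision[of f g r s] deg rs by (metis rangeI)
  have D2: "p = q" if "g p = g q" "f t = g p" for p q t
    using not_in_range_if_collision[of g f p q] deg that total_degree_commute by (metis rangeI)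
  have sP: "s \<in> P" by (simp add: P_def alternating_path_start)
  have step: "q \<in> P" if "p \<in> P" "g p = f q" for p q
    using that alternating_path_step unfolding P_def by metis
  have pred: "p = s \<or> (\<exists>q\<in>P. g q = f p)" if "p \<in> P" for p
    using that alternating_path_pred unfolding P_def by metis
  have rP: "r \<notin> P" using pred[of r] rs e by auto
  have g': "f p \<noteq> g q" if "p \<in> P" "q \<notin> P" for p q
    using pred[OF that(1)] e D2 that(2) by metis
  have "collisions (swap_on P f g) (swap_on P g f) \<subseteq> collisions f g"
    using step g' by (fastforce simp: collisions_def swap_on_def split: if_splits)
  moreover have "(r, s) \<in> collisions f g"
    using rs by (simp add: collisions_def)
  moreover have "(r, s) \<notin> collisions (swap_on P f g) (swap_on P g f)"
    using rP sP e rs(2) by (simp add: collisions_def swap_on_def) metis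
  ultimately show ?thesis by blast
qed

text \<open>The maps \<open>f\<close> and \<open>g\<close> list the two edges at each \<open>r\<close> of a bipartite multigraph. Swapping them
  along an alternating path that starts at a collision removes this collision and creates none.\<close>

lemma exists_injective_swap:
  fixes f g :: "'r::finite \<Rightarrow> 'e"
  assumes "\<And>e. total_degree f g e \<le> 2"
  shows "\<exists>f' g'. inj f' \<and> inj g' \<and>
    (\<forall>r. f' r = f r \<and> g' r = g r \<or> f' r = g r \<and> g' r = f r)"
  using assms
proof (induction "card (collisions f g)" arbitrary: f g rule: less_induct)
  case less
  have IH: ?case if "collisions (swap_on P f g) (swap_on P g f) \<subset> collisions f g" for P
  proof -
    have "card (collisions (swap_on P f g) (swap_on P g f)) < card (collisions f g)"
      using that by (simp add: psubset_card_mono)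
    then obtain f' g' where "inj f'" "inj g'" "\<forall>r. f' r = swap_on P f g r \<and> g' r = swap_on P g f r \<or>
        f' r = swap_on P g f r \<and> g' r = swap_on P f g r"
      using less.hyps[of "swap_on P f g" "swap_on P g f"] less.prems by (auto simp: total_degree_swap_on)
    then show ?thesis
      by (intro exI[of _ f'] exI[of _ g']) (auto simp: swap_on_def split: if_splits)
  qed
  show ?case
  proof (cases "collisions f g = {}")
    case True
    then have "inj f" "inj g" by (auto simp: collisions_def inj_def)
    then show ?thesis by blast
  next
    case False
    then obtain r s where rs: "r \<noteq> s" "f r = f s \<or> g r = g s"
      by (auto simp: collisions_def)
    from rs(2) show ?thesis
    proof
      assume "f r = f s"
      then show ?thesis
        using collisions_decrease[OF less.prems rs(1)] IH by blast
    next
      assume "g r = g s"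
      moreover have "collisions f g = collisions g f" for f g :: "'r \<Rightarrow> 'e"
        by (auto simp: collisions_def)
      ultimately show ?thesis
        using collisions_decrease[of g f r s] less.prems rs(1) IH by (metis total_degree_commute)
    qed
  qed
qed

text \<open>All \<open>f\<close>-images on the path except \<open>f s\<close> are also \<open>g\<close>-images on the path, so by counting exactly
  one \<open>g\<close>-image \<open>y\<close> on the path lies outside the range of \<open>f\<close>.\<close>

lemma alternating_path_swap:
  fixes f g :: "'r::finite \<Rightarrow> 'e"
  assumes f: "inj f" and g: "inj g" and s: "f s \<notin> range g"
  defines "P \<equiv> alternating_path f g s"
  obtains y where "y \<in> range g" "y \<notin> range f"
    "inj (swap_on P f g)" "inj (swap_on P g f)"
    "range (swap_on P f g) = insert y (range f - {f s})"
    "range (swap_on P g f) = insert (f s) (range g - {y})"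
    "\<And>r. r \<in> P \<Longrightarrow> f r \<in> insert (f s) (range g)" "\<And>r. r \<in> P \<Longrightarrow> g r \<in> insert y (range f)"
    "\<And>r. r \<notin> P \<Longrightarrow> f r \<noteq> f s" "\<And>r. r \<notin> P \<Longrightarrow> g r \<noteq> y"
proof -
  have sP: "s \<in> P" by (simp add: P_def alternating_path_start)
  have step: "q \<in> P" if "p \<in> P" "g p = f q" for p q
    using that alternating_path_step unfolding P_def by metis
  have pred: "p = s \<or> (\<exists>q\<in>P. g q = f p)" if "p \<in> P" for p
    using that alternating_path_pred unfolding P_def by metis
  have fP: "f ` P = insert (f s) (g ` P \<inter> range f)"
    using sP step pred by (auto simp: image_iff) metis
  have "card P = card (f ` P)" "card P = card (g ` P)"
    using f g by (simp_all add: card_image inj_on_subset)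
  moreover have "card (f ` P) = Suc (card (g ` P \<inter> range f))"
    unfolding fP using s by (subst card_insert_disjoint) auto
  moreover have "card (g ` P) = card (g ` P \<inter> range f) + card (g ` P - range f)"
    by (subst card_Un_disjoint[symmetric]) (auto intro: arg_cong[where f = card])
  ultimately have "card (g ` P - range f) = 1" by linarith
  then obtain y where y: "g ` P - range f = {y}" by (rule card_1_singletonE)
  then have gP: "g ` P = insert y (g ` P \<inter> range f)" by auto
  have part: "range f = f ` P \<union> f ` (- P)" "range g = g ` P \<union> g ` (- P)" by auto
  have disj: "f ` P \<inter> f ` (- P) = {}" "g ` P \<inter> g ` (- P) = {}"
    using f g by (auto simp: inj_def)
  have swap: "range (swap_on P f' g') = g' ` P \<union> f' ` (- P)" for f' g' :: "'r \<Rightarrow> 'e"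
    by (auto simp: swap_on_def split: if_splits)
  \<comment> \<open>With \<open>cross'\<close> below, no column is shared by a row on the path and a
    row off it through edges of different kinds. This is the injectivity of the two swapped
    maps.\<close>
  have cross: "g p \<noteq> f q" if "p \<in> P" "q \<notin> P" for p q
    using step that by blast
  have cross': "f p \<noteq> g q" if "p \<in> P" "q \<notin> P" for p q
    using pred[OF that(1)] s that(2) g by (metis injD rangeI)
  have ns: "g t \<noteq> f s" for t using s by (metis rangeI)
  have ysub: "y \<in> g ` P" "y \<notin> range f" using y by auto
  show thesis
  proof (rule that)
    show "y \<in> range g" "y \<notin> range f" using ysub by auto
    show "inj (swap_on P f g)" "inj (swap_on P g f)"
      using f g cross cross' by (simp_all add: inj_def swap_on_def) metis+
    have "f s \<in> f ` P" using sP by simp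
    show "range (swap_on P f g) = insert y (range f - {f s})"
    proof -
      have "g ` P = insert y (f ` P - {f s})" using gP fP ns by auto
      moreover have "f s \<notin> f ` (- P)" using sP f by (auto simp: inj_eq)
      ultimately show ?thesis unfolding swap part(1) by auto
    qed
    show "range (swap_on P g f) = insert (f s) (range g - {y})"
    proof -
      have "f ` P = insert (f s) (g ` P - {y})" using gP fP ysub by auto
      moreover have "y \<notin> g ` (- P)" using ysub disj by auto
      ultimately show ?thesis unfolding swap part(2) by auto
    qed
    show "f r \<in> insert (f s) (range g)" if "r \<in> P" for r using that fP by blast
    show "g r \<in> insert y (range f)" if "r \<in> P" for r using that gP by blast
    show "f r \<noteq> f s" if "r \<notin> P" for r using that sP f by (metis injD)
    show "g r \<noteq> y" if "r \<notin> P" for r using that ysub g by (metis imageE injD)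
  qed
qed

section \<open>The exchange between two pairs of matchings of the field\<close>

lemma row_sum_two:
  fixes w :: "'e::finite \<Rightarrow> nat"
  assumes "(\<Sum>e\<in>UNIV. w e) = 2"
  shows "\<exists>a b. \<forall>e. w e = of_bool (a = e) + of_bool (b = e)"
proof -
  obtain a where a: "w a > 0"
    using assms by (metis gr0I sum.neutral zero_neq_numeral)
  define v where "v e = w e - of_bool (a = e)" for e
  have w: "w e = of_bool (a = e) + v e" for e using a by (auto simp: v_def)
  then have "(\<Sum>e\<in>UNIV. w e) = 1 + (\<Sum>e\<in>UNIV. v e)"
    by (simp add: w sum.distrib of_bool_def)
  then have "(\<Sum>e\<in>UNIV. v e) = 1" using assms by simp
  then obtain b where "v b = 1" "\<forall>e. b \<noteq> e \<longrightarrow> v e = 0"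
    using sum_eq_1_iff[of UNIV v] by auto
  then have "v e = of_bool (b = e)" for e by (cases "b = e") auto
  with w show ?thesis by metis
qed

lemma distinct_four_split:
  assumes "card (F \<inter> {x1, x2, y1, y2}) = 2" "x1 \<in> F"
  obtains b where "b \<in> {x2, y1, y2}" "F \<inter> {x1, x2, y1, y2} = {x1, b}"
proof -
  have "card (F \<inter> {x1, x2, y1, y2} - {x1}) = 1"
    by (subst card_Diff_singleton) (use assms in auto)
  then obtain b where "F \<inter> {x1, x2, y1, y2} - {x1} = {b}" by (rule card_1_singletonE)
  then show thesis using assms(2) by (intro that[of b]) auto
qed

text \<open>The triples are the orderings of the three elements other than \<open>x1\<close>:
  \<open>b\<close> is the partner of \<open>x1\<close> in the range of \<open>f\<close>, the path
  from \<open>x1\<close> ends at \<open>c\<close>, and \<open>d\<close> is left over. The last two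
  conclusions say on which side of \<open>P\<close> the four elements may be used; they decide the
  signs in \<open>chi_exchange\<close>.\<close>

lemma matching_field_exchange:
  fixes M :: "'e::finite set \<Rightarrow> ('r::finite \<times> 'e) set"
  assumes M: "polyhedral_matching_field M" and X: "length X + 2 = CARD('r)"
    and dist: "distinct (x1 # x2 # y1 # y2 # X)"
  obtains b c d f g P where "(b, c, d) \<in> {(x2, y1, y2), (x2, y2, y1), (y1, x2, y2), (y1, y2, x2),
      (y2, x2, y1), (y2, y1, x2)}"
    "inj f" "range f = {x1, b} \<union> set X" "M (range f) = graph_of f"
    "inj g" "range g = {c, d} \<union> set X" "M (range g) = graph_of g"
    "inj (swap_on P f g)" "range (swap_on P f g) = {c, b} \<union> set X"
    "M (range (swap_on P f g)) = graph_of (swap_on P f g)"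
    "inj (swap_on P g f)" "range (swap_on P g f) = {x1, d} \<union> set X"
    "M (range (swap_on P g f)) = graph_of (swap_on P g f)"
    "\<And>r. r \<in> P \<Longrightarrow> f r \<noteq> b \<and> g r \<noteq> d" "\<And>r. r \<notin> P \<Longrightarrow> f r \<noteq> x1 \<and> g r \<noteq> c"
proof -
  let ?Y = "{x1, x2, y1, y2}"
  \<comment> \<open>The prescribed column degrees add up to \<open>2 * (CARD('r) - 2) + 4\<close>,
    which equals the total of degree two at every row.\<close>
  define m :: "'e \<Rightarrow> nat" where "m = (\<lambda>e. 2 * of_bool (e \<in> set X) + of_bool (e \<in> ?Y))"
  have "card (set X) = length X" "card ?Y = 4" "set X \<inter> ?Y = {}"
    using dist by (auto simp: distinct_card)
  moreover have "sum m UNIV = 2 * card (set X) + card ?Y"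
  proof -
    have "(\<Sum>e\<in>UNIV. of_bool (e \<in> A)) = card A" for A :: "'e set" by simp
    then show ?thesis by (simp only: m_def sum.distrib flip: sum_distrib_left)
  qed
  ultimately have "(\<Sum>r\<in>(UNIV :: 'r set). 2) = sum m UNIV" using X by simp
  moreover have "(\<Sum>r\<in>(UNIV :: 'r set). 2 :: nat) > 0" using X by simp
  ultimately obtain w :: "'r \<times> 'e \<Rightarrow> nat" where w: "\<And>r. (\<Sum>e\<in>UNIV. w (r, e)) = 2"
      "\<And>e. (\<Sum>r\<in>UNIV. w (r, e)) = m e"
    and wM: "\<And>f. inj f \<Longrightarrow> (\<And>r. 0 < w (r, f r)) \<Longrightarrow> M (range f) = graph_of f"
    by (rule matching_field_integral_flow[OF M]) (rule that, assumption, assumption, simp)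
  \<comment> \<open>The two edges at each row, equal in the case of a double edge; neither map needs
    to be injective yet.\<close>
  obtain f0 g0 where fg0: "\<And>r e. w (r, e) = of_bool (f0 r = e) + of_bool (g0 r = e)"
    using row_sum_two[OF w(1)] by metis
  have m2: "m e \<le> 2" for e using dist by (auto simp: m_def)
  have deg0: "total_degree f0 g0 e = m e" for e
    using w(2)[of e] by (simp add: total_degree_def fg0)
  obtain f1 g1 where fg1: "inj f1" "inj g1"
    "\<And>r. f1 r = f0 r \<and> g1 r = g0 r \<or> f1 r = g0 r \<and> g1 r = f0 r"
    using exists_injective_swap[of f0 g0] m2 deg0 by metis
  define splits where "splits f g \<longleftrightarrow> inj f \<and> inj g \<and> (\<forall>r e. w (r, e) = of_bool (f r = e) + of_bool (g r = e))"
    for f g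
  have "splits f1 g1" "splits g1 f1"
    using fg1 fg0 unfolding splits_def by (metis add.commute)+
  have deg: "m e = of_bool (e \<in> range f) + of_bool (e \<in> range g)" if "splits f g" for f g e
    using that w(2)[of e] total_degree_inj[of f g e] by (simp add: splits_def total_degree_def)
  have "x1 \<in> range f1 \<or> x1 \<in> range g1"
    using deg[OF \<open>splits f1 g1\<close>, of x1] by (auto simp: m_def of_bool_def split: if_splits)
  \<comment> \<open>The two injective maps play symmetric roles, so \<open>f\<close> can be taken to
    be the one that meets \<open>x1\<close>.\<close>
  then obtain f g where fg: "splits f g" and x1f: "x1 \<in> range f"
    using \<open>splits f1 g1\<close> \<open>splits g1 f1\<close> by blast
  have inj: "inj f" "inj g" using fg by (auto simp: splits_def)
  have memX: "e \<in> range f \<and> e \<in> range g" if "e \<in> set X" for e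
    using deg[OF fg, of e] that by (auto simp: m_def of_bool_def split: if_splits)
  have memY: "e \<in> range f \<longleftrightarrow> e \<notin> range g" if "e \<in> ?Y" for e
    using deg[OF fg, of e] that dist by (auto simp: m_def of_bool_def split: if_splits)
  have memO: "e \<notin> range f \<and> e \<notin> range g" if "e \<notin> ?Y" "e \<notin> set X" for e
    using deg[OF fg, of e] that by (auto simp: m_def of_bool_def split: if_splits)
  have rf: "range f = range f \<inter> ?Y \<union> set X" using memX memO by blast
  have rg: "range g = (?Y - range f) \<union> set X" using memX memO memY by blast
  \<comment> \<open>The range of \<open>f\<close> contains the \<open>CARD('r) - 2\<close> elements
    of \<open>X\<close>, which leaves room for exactly two of the four elements.\<close>
  have "card (range f) = CARD('r)" using inj(1) by (rule card_image)
  moreover have "card (range f \<inter> ?Y \<union> set X) = card (range f \<inter> ?Y) + card (set X)"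
    using \<open>set X \<inter> ?Y = {}\<close> by (intro card_Un_disjoint) auto
  ultimately have "card (range f \<inter> ?Y) = 2"
    using rf X \<open>card (set X) = length X\<close> by simp
  then obtain b where b: "b \<in> {x2, y1, y2}" "range f \<inter> ?Y = {x1, b}"
    by (rule distinct_four_split[OF _ x1f]) (rule that)
  have rangef: "range f = {x1, b} \<union> set X" using rf b(2) by simp
  have rangeg: "range g = ({x2, y1, y2} - {b}) \<union> set X"
  proof -
    have "?Y - range f = ?Y - {x1, b}" using b(2) by blast
    also have "\<dots> = {x2, y1, y2} - {b}" using dist by auto
    finally show ?thesis using rg by simp
  qed
  obtain s where s: "x1 = f s" using x1f by (rule imageE)
  then have sg: "f s \<notin> range g" using memY[of x1] x1f by simp
  define P where "P = alternating_path f g s"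
  obtain c where c: "c \<in> range g" "c \<notin> range f"
    and inj2: "inj (swap_on P f g)" "inj (swap_on P g f)"
    and range2: "range (swap_on P f g) = insert c (range f - {f s})"
      "range (swap_on P g f) = insert (f s) (range g - {c})"
    and P: "\<And>r. r \<in> P \<Longrightarrow> f r \<in> insert (f s) (range g)" "\<And>r. r \<in> P \<Longrightarrow> g r \<in> insert c (range f)"
    and notP: "\<And>r. r \<notin> P \<Longrightarrow> f r \<noteq> f s" "\<And>r. r \<notin> P \<Longrightarrow> g r \<noteq> c"
    using alternating_path_swap[OF inj sg] unfolding P_def by blast
  have pos: "0 < w (r, f r)" "0 < w (r, g r)" for r
    using fg by (simp_all add: splits_def)
  then have pos2: "0 < w (r, swap_on P f g r)" "0 < w (r, swap_on P g f r)" for r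
    by (simp_all add: swap_on_def)
  have cY: "c \<in> {x2, y1, y2} - {b}"
    using c unfolding rangef rangeg by blast
  then obtain d where bcd: "(b, c, d) \<in> {(x2, y1, y2), (x2, y2, y1), (y1, x2, y2), (y1, y2, x2),
      (y2, x2, y1), (y2, y1, x2)}"
    using b(1) by auto
  then have d: "{x2, y1, y2} - {b} = {c, d}" "c \<noteq> d"
    using dist by auto
  have facts: "x1 \<noteq> b" "x1 \<notin> set X" "b \<notin> set X" "c \<notin> set X" "d \<notin> set X" "b \<noteq> c" "b \<noteq> d" "x1 \<noteq> c" "x1 \<noteq> d"
    using bcd dist by auto
  have rangeg': "range g = {c, d} \<union> set X" using rangeg d(1) by simp
  show thesis
  proof (rule that[OF bcd inj(1) rangef wM[OF inj(1) pos(1)] inj(2) rangeg' wM[OF inj(2) pos(2)]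
        inj2(1) _ wM[OF inj2(1) pos2(1)] inj2(2) _ wM[OF inj2(2) pos2(2)]])
    show "range (swap_on P f g) = {c, b} \<union> set X"
      using range2(1) facts unfolding rangef s[symmetric] by auto
    show "range (swap_on P g f) = {x1, d} \<union> set X"
      using range2(2) facts d(2) unfolding rangeg' s[symmetric] by auto
    show "f r \<noteq> b \<and> g r \<noteq> d" if "r \<in> P" for r
      using P[OF that] facts d(2) unfolding rangef rangeg' s[symmetric] by auto
    show "f r \<noteq> x1 \<and> g r \<noteq> c" if "r \<notin> P" for r
      using notP[OF that] s by auto
  qed
qed

section \<open>Signs\<close>

lemma exists_permute_list:
  assumes "distinct xs" "distinct ys" "set xs = set ys"
  obtains \<pi> where "\<pi> permutes {..<length xs}" "permute_list \<pi> xs = ys"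
proof -
  have "mset ys = mset xs" using assms by (simp add: set_eq_iff_mset_eq_distinct)
  then show thesis by (rule mset_eq_permutation) (rule that)
qed

text \<open>One permutation \<open>h\<close> accounts for both changes:
  \<open>\<pi>' = \<pi> \<circ> h\<close> and \<open>\<rho> = \<rho>' \<circ> h\<close>, so its sign
  enters both products. The second identity holds because \<open>h\<close> fixes every index outside
  \<open>K\<close> and therefore preserves \<open>K\<close>, where the two pairs are
  interchanged.\<close>

lemma sign_swap_on:
  assumes perm: "\<pi> permutes {..<n::nat}" "\<rho> permutes {..<n}" "\<pi>' permutes {..<n}" "\<rho>' permutes {..<n}"
    and K: "\<And>k. k < n \<Longrightarrow> k \<in> K \<Longrightarrow> \<pi>' k = \<rho> k \<and> \<rho>' k = \<pi> k"
    and notK: "\<And>k. k < n \<Longrightarrow> k \<notin> K \<Longrightarrow> \<pi>' k = \<pi> k \<and> \<rho>' k = \<rho> k"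
  shows "sign \<pi> * sign \<rho> = sign \<pi>' * sign \<rho>'"
proof -
  define h where "h = inv_into UNIV \<pi> \<circ> \<pi>'"
  have h: "h permutes {..<n}"
    unfolding h_def using perm by (intro permutes_compose permutes_inv)
  have \<pi>h: "\<pi> (h k) = \<pi>' k" for k
    using permutes_surj[OF perm(1)] by (simp add: h_def surj_f_inv_f)
  have \<rho>h: "\<rho>' (h k) = \<rho> k" for k
  proof (cases "k < n")
    case False
    then show ?thesis
      using h perm by (simp add: permutes_def)
  next
    case True
    then have hk: "h k < n" using permutes_in_image[OF h, of k] by simp
    have "h k \<in> K \<longleftrightarrow> k \<in> K"
    proof (cases "h k \<in> K")
      case False
      then have "\<pi>' (h k) = \<pi>' k" using notK[OF hk] \<pi>h by simp
      then have "h k = k" using permutes_inj[OF perm(3)] by (simp add: inj_eq)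
      then show ?thesis by simp
    next
      case True
      have "k \<in> K"
      proof (rule ccontr)
        assume "k \<notin> K"
        then have "\<pi> (h k) = \<pi> k" using notK[OF \<open>k < n\<close>] \<pi>h by simp
        then have "h k = k" using permutes_inj[OF perm(1)] by (simp add: inj_eq)
        then show False using True \<open>k \<notin> K\<close> by simp
      qed
      then show ?thesis using True by simp
    qed
    then show ?thesis
    proof (cases "k \<in> K")
      case True
      then show ?thesis
        using K[OF hk] K[OF \<open>k < n\<close>] \<pi>h[of k] \<open>h k \<in> K \<longleftrightarrow> k \<in> K\<close> by simp
    next
      case False
      then have "\<pi> (h k) = \<pi> k" using notK[OF \<open>k < n\<close>] \<pi>h by simp
      then have "h k = k" using permutes_inj[OF perm(1)] by (simp add: inj_eq)
      then show ?thesis using False notK[OF \<open>k < n\<close>] by simp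
    qed
  qed
  have "permutation p" if "p permutes {..<n}" for p
    using that permutes_imp_permutation by blast
  then have "sign (\<pi> \<circ> h) = sign \<pi> * sign h" "sign (\<rho>' \<circ> h) = sign \<rho>' * sign h"
    using perm h by (simp_all add: sign_compose)
  moreover have "\<pi> \<circ> h = \<pi>'" "\<rho>' \<circ> h = \<rho>" using \<pi>h \<rho>h by auto
  moreover have "sign h * sign h = 1" by (simp add: sign_idempotent)
  ultimately show ?thesis by (simp add: mult.assoc mult.left_commute)
qed

section \<open>Hyperfields and opposite terms\<close>

context hyperfield
begin

lemma one_closed: "\<one> \<in> carrier H" and one_nonzero: "\<one> \<noteq> hzero H"
proof -
  interpret N: comm_group "H\<lparr>carrier := carrier H - {hzero H}\<rparr>" by (rule nonzero_comm_group)
  show "\<one> \<in> carrier H" using N.one_closed by simp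
  show "\<one> \<noteq> hzero H" using zero_neq_one by simp
qed

lemma mult_nonzero:
  assumes "x \<in> carrier H" "y \<in> carrier H" "x \<noteq> hzero H" "y \<noteq> hzero H"
  shows "x \<otimes> y \<in> carrier H" "x \<otimes> y \<noteq> hzero H"
proof -
  interpret N: comm_group "H\<lparr>carrier := carrier H - {hzero H}\<rparr>" by (rule nonzero_comm_group)
  show "x \<otimes> y \<in> carrier H" "x \<otimes> y \<noteq> hzero H"
    using N.m_closed[of x y] assms by auto
qed

text \<open>The axioms provide a group of nonzero elements only. Extending the laws to zero makes
  \<open>finprod\<close> and its rules available on the whole carrier.\<close>

sublocale comm_monoid H
proof -
  interpret N: comm_group "H\<lparr>carrier := carrier H - {hzero H}\<rparr>" by (rule nonzero_comm_group)
  have closed: "x \<otimes> y \<in> carrier H" if "x \<in> carrier H" "y \<in> carrier H" for x y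
    using that mult_nonzero(1) zero_mult mult_zero zero_closed by (cases "x = hzero H"; cases "y = hzero H") auto
  show "comm_monoid H"
  proof (rule comm_monoidI)
    show "x \<otimes> y \<in> carrier H" if "x \<in> carrier H" "y \<in> carrier H" for x y
      using that by (rule closed)
    show "\<one> \<in> carrier H" by (rule one_closed)
    show "(x \<otimes> y) \<otimes> z = x \<otimes> (y \<otimes> z)"
      if x: "x \<in> carrier H" and y: "y \<in> carrier H" and z: "z \<in> carrier H" for x y z
    proof (cases "x = hzero H \<or> y = hzero H \<or> z = hzero H")
      case True
      then show ?thesis using x y z closed by (auto simp: zero_mult mult_zero)
    next
      case False
      then show ?thesis using N.m_assoc[of x y z] x y z by simp
    qed
    show "\<one> \<otimes> x = x" if "x \<in> carrier H" for x
      using that N.l_one[of x] one_closed by (cases "x = hzero H") (simp_all add: mult_zero)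
    show "x \<otimes> y = y \<otimes> x" if "x \<in> carrier H" "y \<in> carrier H" for x y
      using that N.m_comm[of x y] by (cases "x = hzero H \<or> y = hzero H") (auto simp: mult_zero zero_mult)
  qed
qed

lemma exists_inverse:
  assumes "x \<in> carrier H" "x \<noteq> hzero H"
  shows "\<exists>y\<in>carrier H. x \<otimes> y = \<one>"
proof -
  interpret N: comm_group "H\<lparr>carrier := carrier H - {hzero H}\<rparr>" by (rule nonzero_comm_group)
  have "x \<in> carrier (H\<lparr>carrier := carrier H - {hzero H}\<rparr>)" using assms by simp
  then show ?thesis using N.r_inv N.inv_closed by auto
qed

lemma finprod_nonzero:
  assumes "finite S" "\<And>x. x \<in> S \<Longrightarrow> h x \<in> carrier H \<and> h x \<noteq> hzero H"
  shows "finprod H h S \<in> carrier H \<and> finprod H h S \<noteq> hzero H"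
  using assms
proof (induction S)
  case empty
  then show ?case using one_closed one_nonzero by simp
next
  case (insert x S)
  then have "h \<in> S \<rightarrow> carrier H" by auto
  then show ?case using insert mult_nonzero by (simp add: finprod_insert)
qed

lemma hneg_in:
  assumes "x \<in> carrier H"
  shows hneg_closed: "hneg H x \<in> carrier H" and zero_in_hadd_hneg: "hzero H \<in> x \<boxplus> hneg H x"
  using theI'[OF neg_ex1[OF assms]] by (simp_all add: hneg_def)

lemma hneg_unique:
  assumes "x \<in> carrier H" "y \<in> carrier H" "hzero H \<in> x \<boxplus> y"
  shows "y = hneg H x"
  using neg_ex1[OF assms(1)] assms hneg_in[OF assms(1)] by blast

lemma hneg_hneg: "x \<in> carrier H \<Longrightarrow> hneg H (hneg H x) = x"
  using hneg_unique[of "hneg H x" x] hneg_in[of x] hadd_commute by simp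

lemma hneg_zero: "hneg H (hzero H) = hzero H"
  using hneg_unique[of "hzero H" "hzero H"] zero_closed zero_hadd by simp

lemma hneg_eq_zero_iff: "x \<in> carrier H \<Longrightarrow> hneg H x = hzero H \<longleftrightarrow> x = hzero H"
  using hneg_hneg hneg_zero by metis

text \<open>Distributivity carries the zero in \<open>y \<boxplus> -y\<close> to a zero in
  \<open>x \<otimes> y \<boxplus> x \<otimes> -y\<close>, and negatives are unique.\<close>

lemma mult_hneg:
  assumes "x \<in> carrier H" "y \<in> carrier H"
  shows "x \<otimes> hneg H y = hneg H (x \<otimes> y)"
proof (rule hneg_unique)
  show "hzero H \<in> x \<otimes> y \<boxplus> x \<otimes> hneg H y"
    using distrib[of x y "hneg H y"] assms hneg_in[OF assms(2)] mult_zero[OF assms(1)]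
    by (metis image_eqI)
qed (use assms hneg_closed in auto)

lemma hneg_mult:
  assumes "x \<in> carrier H" "y \<in> carrier H"
  shows "hneg H x \<otimes> y = hneg H (x \<otimes> y)"
  using assms mult_hneg[of y x] by (simp add: m_comm hneg_closed)

lemma hsign_closed: "hsign H s \<in> carrier H"
  by (simp add: hsign_def hneg_closed)

lemma hsign_nonzero: "hsign H s \<noteq> hzero H"
  by (simp add: hsign_def hneg_eq_zero_iff one_nonzero)

text \<open>The restriction to \<open>1\<close> and \<open>-1\<close> matters because
  \<open>hsign\<close> sends every integer other than \<open>1\<close> to the negative of
  one.\<close>

lemma hsign_mult:
  assumes "s \<in> {1, -1}" "t \<in> {1, -1}"
  shows "hsign H s \<otimes> hsign H t = hsign H (s * t)"
  using assms by (auto simp: hsign_def hneg_closed hneg_mult mult_hneg hneg_hneg)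

lemma hsign_square: "s \<in> {1, -1} \<Longrightarrow> hsign H s \<otimes> hsign H s = \<one>"
  using hsign_mult[of s s] by (auto simp: hsign_def)

end

lemma sign_cases: "sign p \<in> {1, -1}"
  by (simp add: sign_def)

text \<open>Two terms \<open>u\<close> and \<open>-u\<close> in any positions, with third term
  \<open>v\<close>. For \<open>u\<close> zero the hypersum is just \<open>{v}\<close>, hence the
  side condition that \<open>v\<close> then vanishes too.\<close>

definition cancelling :: "('a, 'm) hyperstruct_scheme \<Rightarrow> 'a \<Rightarrow> 'a \<Rightarrow> 'a \<Rightarrow> bool" where
  "cancelling H a b c \<longleftrightarrow> (\<exists>u\<in>carrier H. \<exists>v\<in>carrier H. (u \<noteq> hzero H \<or> v = hzero H) \<and>
    (a = u \<and> b = hneg H u \<and> c = v \<or> a = u \<and> b = v \<and> c = hneg H u \<or> a = v \<and> b = u \<and> c = hneg H u))"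

lemma cancelling_if_opposite:
  assumes "a \<in> carrier H" "b \<in> carrier H" "c \<in> carrier H"
    and "b = hneg H a \<and> (a \<noteq> hzero H \<or> c = hzero H) \<or> c = hneg H a \<and> (a \<noteq> hzero H \<or> b = hzero H)
      \<or> c = hneg H b \<and> (b \<noteq> hzero H \<or> a = hzero H)"
  shows "cancelling H a b c"
  using assms unfolding cancelling_def by blast

text \<open>For nonzero \<open>u\<close>, if the opposite terms come first, their hypersum is
  everything and contains \<open>-v\<close>. Otherwise \<open>u\<close> absorbs \<open>v\<close> by
  \<open>self\<close> and then meets \<open>-u\<close>. The assumptions isolate what the canonical
  inflation and the hyperfields with the inflation property have in common.\<close>

lemma zero_in_hadd3_if_cancelling:
  assumes canc: "cancelling K a b c" and zero: "hzero K \<in> carrier K"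
    and hadd_zero: "hzero K \<boxplus>\<^bsub>K\<^esub> hzero K = {hzero K}" "hneg K (hzero K) = hzero K"
    and neg: "\<And>u. u \<in> carrier K \<Longrightarrow> hneg K u \<in> carrier K \<and> hzero K \<in> u \<boxplus>\<^bsub>K\<^esub> hneg K u \<and> hzero K \<in> hneg K u \<boxplus>\<^bsub>K\<^esub> u"
    and full: "\<And>u. u \<in> carrier K \<Longrightarrow> u \<noteq> hzero K \<Longrightarrow> u \<boxplus>\<^bsub>K\<^esub> hneg K u = carrier K"
    and self: "\<And>u v. u \<in> carrier K \<Longrightarrow> v \<in> carrier K \<Longrightarrow> u \<noteq> hzero K \<Longrightarrow> u \<in> u \<boxplus>\<^bsub>K\<^esub> v \<and> u \<in> v \<boxplus>\<^bsub>K\<^esub> u"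
  shows "hzero K \<in> hadd3 K a b c"
proof -
  obtain u v where uv: "u \<in> carrier K" "v \<in> carrier K" "u \<noteq> hzero K \<or> v = hzero K"
    "a = u \<and> b = hneg K u \<and> c = v \<or> a = u \<and> b = v \<and> c = hneg K u \<or> a = v \<and> b = u \<and> c = hneg K u"
    using canc by (auto simp: cancelling_def)
  show ?thesis
  proof (cases "u = hzero K")
    case True
    then have "a = hzero K" "b = hzero K" "c = hzero K" using uv hadd_zero by auto
    then show ?thesis using hadd_zero by (simp add: hadd3_def)
  next
    case False
    from uv(4) show ?thesis
    proof (elim disjE conjE)
      assume "a = u" "b = hneg K u" "c = v"
      then show ?thesis using full[OF uv(1) False] neg[OF uv(2)] by (auto simp: hadd3_def)
    next
      assume "a = u" "b = v" "c = hneg K u"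
      then show ?thesis using self[OF uv(1,2) False] neg[OF uv(1)] by (auto simp: hadd3_def)
    next
      assume "a = v" "b = u" "c = hneg K u"
      then show ?thesis using self[OF uv(1,2) False] neg[OF uv(1)] by (auto simp: hadd3_def)
    qed
  qed
qed

text \<open>The summands \<open>a\<close> and \<open>b\<close> are added to a hypersum only when
  both are nonzero, so zero enters only the sums of opposite elements, where it already was.\<close>

lemma (in hyperfield) hneg_canonical_inflation:
  assumes "x \<in> carrier H"
  shows "hneg (canonical_inflation H) x = hneg H x"
  unfolding hneg_def[of "canonical_inflation H"]
proof (rule the_equality)
  show "hneg H x \<in> carrier (canonical_inflation H) \<and>
    hzero (canonical_inflation H) \<in> x \<boxplus>\<^bsub>canonical_inflation H\<^esub> hneg H x"
    using assms hneg_closed hneg_zero zero_closed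
    by (auto simp: canonical_inflation_def hneg_eq_zero_iff hneg_zero)
  fix y assume "y \<in> carrier (canonical_inflation H) \<and>
    hzero (canonical_inflation H) \<in> x \<boxplus>\<^bsub>canonical_inflation H\<^esub> y"
  then show "y = hneg H x"
    using assms hneg_unique[of x y] hneg_zero
    by (auto simp: canonical_inflation_def split: if_splits)
qed

lemma (in hyperfield) zero_in_hadd3_canonical_inflation:
  assumes "cancelling H a b c"
  shows "hzero (canonical_inflation H) \<in> hadd3 (canonical_inflation H) a b c"
proof (rule zero_in_hadd3_if_cancelling)
  let ?K = "canonical_inflation H"
  have sel: "carrier ?K = carrier H" "hzero ?K = hzero H"
    by (simp_all add: canonical_inflation_def)
  show "cancelling ?K a b c"
    using assms unfolding cancelling_def sel by (metis hneg_canonical_inflation)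
  show "hzero ?K \<in> carrier ?K" using zero_closed by (simp add: sel)
  show "hzero ?K \<boxplus>\<^bsub>?K\<^esub> hzero ?K = {hzero ?K}" by (simp add: canonical_inflation_def)
  show "hneg ?K (hzero ?K) = hzero ?K"
    by (simp add: sel hneg_canonical_inflation zero_closed hneg_zero)
  fix u assume u: "u \<in> carrier ?K"
  then show "hneg ?K u \<in> carrier ?K \<and> hzero ?K \<in> u \<boxplus>\<^bsub>?K\<^esub> hneg ?K u \<and> hzero ?K \<in> hneg ?K u \<boxplus>\<^bsub>?K\<^esub> u"
    using hneg_closed[of u] zero_closed
    by (auto simp: hneg_canonical_inflation sel)
      (auto simp: canonical_inflation_def hneg_zero hneg_eq_zero_iff hneg_hneg)
  show "u \<boxplus>\<^bsub>?K\<^esub> hneg ?K u = carrier ?K" if "u \<noteq> hzero ?K"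
    using u that by (simp add: hneg_canonical_inflation sel)
      (simp add: canonical_inflation_def hneg_eq_zero_iff)
  show "u \<in> u \<boxplus>\<^bsub>?K\<^esub> v \<and> u \<in> v \<boxplus>\<^bsub>?K\<^esub> u" if "v \<in> carrier ?K" "u \<noteq> hzero ?K" for v
    using u that by (auto simp: canonical_inflation_def)
qed

text \<open>Multiplication by the unit \<open>u\<close> maps
  \<open>\<one> \<boxplus> -\<one>\<close> onto \<open>u \<boxplus> -u\<close> and the carrier onto
  itself.\<close>

lemma (in hyperfield) hadd_hneg_eq_carrier:
  assumes "inflation_property H" "u \<in> carrier H" "u \<noteq> hzero H"
  shows "u \<boxplus> hneg H u = carrier H"
proof -
  have "u \<boxplus> hneg H u = (\<otimes>) u ` (\<one> \<boxplus> hneg H \<one>)"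
    using distrib[of u \<one> "hneg H \<one>"] assms(2) by (simp add: hneg_closed mult_hneg)
  also have "\<dots> = (\<otimes>) u ` carrier H"
    using assms(1) by (simp add: inflation_property_def)
  also have "\<dots> = carrier H"
  proof
    show "(\<otimes>) u ` carrier H \<subseteq> carrier H" using assms(2) by auto
    obtain v where v: "v \<in> carrier H" "u \<otimes> v = \<one>" using exists_inverse assms(2,3) by blast
    show "carrier H \<subseteq> (\<otimes>) u ` carrier H"
    proof
      fix w assume w: "w \<in> carrier H"
      have "w = u \<otimes> (v \<otimes> w)" using v w assms(2) by (simp flip: m_assoc)
      then show "w \<in> (\<otimes>) u ` carrier H" using v w by blast
    qed
  qed
  finally show ?thesis .
qed

lemma (in hyperfield) zero_in_hadd3_inflation_property:
  assumes "inflation_property H" "cancelling H a b c"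
  shows "hzero H \<in> hadd3 H a b c"
proof (rule zero_in_hadd3_if_cancelling[OF assms(2) zero_closed])
  show "hzero H \<boxplus> hzero H = {hzero H}" by (simp add: zero_hadd zero_closed)
  show "hneg H (hzero H) = hzero H" by (rule hneg_zero)
  fix u assume u: "u \<in> carrier H"
  then show "hneg H u \<in> carrier H \<and> hzero H \<in> u \<boxplus> hneg H u \<and> hzero H \<in> hneg H u \<boxplus> u"
    using hneg_in[OF u] hadd_commute by simp
  show full: "u \<boxplus> hneg H u = carrier H" if "u \<noteq> hzero H"
    using hadd_hneg_eq_carrier assms(1) u that by simp
  \<comment> \<open>By reversibility, absorbing \<open>v\<close> means that \<open>v\<close> lies in
    \<open>u \<boxplus> -u\<close>, which is the whole carrier.\<close>
  show "u \<in> u \<boxplus> v \<and> u \<in> v \<boxplus> u" if v: "v \<in> carrier H" and "u \<noteq> hzero H" for v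
    using reversible[OF u u v] full that(2) v hadd_commute[OF u v] by simp
qed

text \<open>The bases are those of the uniform matroid, whose exchange axiom is a comparison of
  cardinalities.\<close>

lemma weak_matroidI:
  fixes chi :: "'e::{finite,linorder} list \<Rightarrow> 'a"
  assumes "alternating K d chi" "d \<le> CARD('e)"
    and nonzero: "\<And>xs. length xs = d \<Longrightarrow> distinct xs \<Longrightarrow> chi xs \<noteq> hzero K"
    and "\<And>x1 x2 y1 y2 X. length X + 2 = d \<Longrightarrow> hzero K \<in> hadd3 K
          (chi (x1 # x2 # X) \<otimes>\<^bsub>K\<^esub> chi (y1 # y2 # X))
          (chi (x1 # y1 # X) \<otimes>\<^bsub>K\<^esub> chi (y2 # x2 # X))
          (chi (x1 # y2 # X) \<otimes>\<^bsub>K\<^esub> chi (x2 # y1 # X))"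
  shows "weak_matroid K d chi"
  unfolding weak_matroid_def
proof (intro conjI allI impI)
  obtain \<sigma> :: "'e set" where \<sigma>: "card \<sigma> = d"
    using assms(2) obtain_subset_with_card_n by metis
  have nz: "chi (sorted_list_of_set \<tau>) \<noteq> hzero K" if "card \<tau> = d" for \<tau> :: "'e set"
    using nonzero[of "sorted_list_of_set \<tau>"] that by simp
  then have B: "{\<sigma>. card \<sigma> = d \<and> chi (sorted_list_of_set \<sigma>) \<noteq> hzero K} = {\<sigma>. card \<sigma> = d}"
    by auto
  show "\<exists>xs. length xs = d \<and> chi xs \<noteq> hzero K"
    using nz[OF \<sigma>] \<sigma> by (intro exI[of _ "sorted_list_of_set \<sigma>"]) simp
  show "matroid_bases {\<sigma>. card \<sigma> = d \<and> chi (sorted_list_of_set \<sigma>) \<noteq> hzero K}"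
    unfolding B matroid_bases_def
  proof (intro conjI ballI)
    show "{\<sigma> :: 'e set. card \<sigma> = d} \<noteq> {}" using \<sigma> by auto
    fix B B' :: "'e set" and x
    assume B: "B \<in> {\<sigma>. card \<sigma> = d}" "B' \<in> {\<sigma>. card \<sigma> = d}" "x \<in> B - B'"
    have "\<not> B' \<subseteq> B"
      using B card_subset_eq[of B B'] by auto
    then obtain y where "y \<in> B' - B" by blast
    moreover have "card (insert y (B - {x})) = d"
      using B \<open>y \<in> B' - B\<close> card_Suc_Diff1[of B x] by (simp add: card_insert_if)
    ultimately show "\<exists>y\<in>B' - B. insert y (B - {x}) \<in> {\<sigma>. card \<sigma> = d}" by blast
  qed
qed (use assms in auto)

section \<open>The three-term relations\<close>

context hyperfield
begin

lemma alternating_closed: "alternating H d chi \<Longrightarrow> length xs = d \<Longrightarrow> chi xs \<in> carrier H"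
  by (simp add: alternating_def)

lemma alternating_not_distinct:
  "alternating H d chi \<Longrightarrow> length xs = d \<Longrightarrow> \<not> distinct xs \<Longrightarrow> chi xs = hzero H"
  by (simp add: alternating_def)

lemma alternating_permute:
  "alternating H d chi \<Longrightarrow> length xs = d \<Longrightarrow> \<pi> permutes {..<d} \<Longrightarrow>
    chi (permute_list \<pi> xs) = hsign H (sign \<pi>) \<otimes> chi xs"
  by (simp add: alternating_def)

lemma alternating_swap:
  assumes "alternating H d chi" "length X + 2 = d"
  shows "chi (y # x # X) = hneg H (chi (x # y # X))"
proof -
  let ?t = "Transposition.transpose 0 (1::nat)"
  have t: "?t permutes {..<d}" using assms(2) by (intro permutes_swap_id) auto
  have "permute_list ?t (x # y # X) = y # x # X"
  proof (rule nth_equalityI)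
    fix i assume "i < length (permute_list ?t (x # y # X))"
    moreover consider "i = 0" | "i = 1" | j where "i = Suc (Suc j)"
      by (metis One_nat_def not0_implies_Suc)
    ultimately show "permute_list ?t (x # y # X) ! i = (y # x # X) ! i"
      using t assms(2) by cases (simp_all add: permute_list_nth Transposition.transpose_def)
  qed simp
  moreover have "sign ?t = -1" by (simp add: sign_swap_id)
  ultimately have "chi (y # x # X) = hneg H \<one> \<otimes> chi (x # y # X)"
    using alternating_permute[OF assms(1) _ t, of "x # y # X"] assms(2) by (simp add: hsign_def)
  then show ?thesis
    using alternating_closed[OF assms(1), of "x # y # X"] assms(2) by (simp add: hneg_mult)
qed

end

locale matching_field_function = hyperfield H
  for H :: "'h hyperstruct" (structure) +
  fixes M :: "'e::{finite,linorder} set \<Rightarrow> ('r::{finite,linorder} \<times> 'e) set"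
    and A :: "'r \<times> 'e \<Rightarrow> 'h"
    and chi :: "'e list \<Rightarrow> 'h"
  assumes field: "polyhedral_matching_field M"
    and A: "A e \<in> carrier H" "A e \<noteq> hzero H"
    and alt: "alternating H CARD('r) chi"
    and chi_sorted: "card \<sigma> = CARD('r) \<Longrightarrow> chi (sorted_list_of_set \<sigma>) =
      hsign H (matching_sign \<sigma> (M \<sigma>)) \<otimes> (\<Otimes>e\<in>M \<sigma>. A e)"
begin

definition row_list :: "'r list" where
  "row_list = sorted_list_of_set UNIV"

lemma row_list: "distinct row_list" "set row_list = UNIV" "length row_list = CARD('r)"
  by (simp_all add: row_list_def)

lemma chi_nonzero:
  assumes "length xs = CARD('r)" "distinct xs"
  shows "chi xs \<noteq> hzero H"
proof -
  let ?ys = "sorted_list_of_set (set xs)"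
  have c: "card (set xs) = CARD('r)" using assms by (simp add: distinct_card)
  obtain \<pi> where \<pi>: "\<pi> permutes {..<length ?ys}" "permute_list \<pi> ?ys = xs"
    by (rule exists_permute_list[of ?ys xs]) (use assms in auto)
  have P: "(\<Otimes>e\<in>M (set xs). A e) \<in> carrier H \<and> (\<Otimes>e\<in>M (set xs). A e) \<noteq> hzero H"
    using A by (intro finprod_nonzero) auto
  then have "chi ?ys \<noteq> hzero H"
    using chi_sorted[OF c] mult_nonzero hsign_closed hsign_nonzero by metis
  moreover have "chi ?ys \<in> carrier H"
    using c by (intro alternating_closed[OF alt]) simp
  moreover have "chi xs = hsign H (sign \<pi>) \<otimes> chi ?ys"
    using alternating_permute[OF alt, of ?ys \<pi>] \<pi> c by simp
  ultimately show ?thesis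
    using mult_nonzero hsign_closed hsign_nonzero by metis
qed

text \<open>Listing \<open>\<sigma>\<close> in the order in which the matching meets the rows removes the sign.\<close>

lemma chi_map_row_list:
  assumes f: "inj f" and M: "M (range f) = graph_of f"
  shows "chi (map f row_list) = (\<Otimes>r\<in>UNIV. A (r, f r))"
proof -
  let ?s = "sorted_list_of_set (range f)"
  have c: "card (range f) = CARD('r)" using f by (rule card_image)
  obtain \<pi> where \<pi>: "\<pi> permutes {..<length ?s}" "permute_list \<pi> ?s = map f row_list"
    by (rule exists_permute_list[of ?s "map f row_list"])
      (use row_list inj_on_subset[OF f] in \<open>auto simp: distinct_map\<close>)
  then have \<pi>': "\<pi> permutes {..<CARD('r)}" using c by simp
  have nth: "?s ! \<pi> k = f (row_list ! k)" if "k < CARD('r)" for k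
    using arg_cong[OF \<pi>(2), of "\<lambda>xs. xs ! k"] that \<pi>(1) c row_list(3) by (simp add: permute_list_nth)
  \<comment> \<open>\<open>\<pi>\<close> sends the position of a row to the position of its partner
    in the sorted range. Its sign thus occurs once in \<open>chi_sorted\<close> and once in the
    reordering, and the two cancel.\<close>
  have "matching_perm (range f) (M (range f)) k = \<pi> k" for k
  proof (cases "k < CARD('r)")
    case True
    have "(THE l. l < card (range f) \<and> (row_list ! k, ?s ! l) \<in> graph_of f) = \<pi> k"
    proof (rule the_equality)
      have "\<pi> k < card (range f)"
        using permutes_in_image[OF \<pi>', of k] True c by simp
      then show "\<pi> k < card (range f) \<and> (row_list ! k, ?s ! \<pi> k) \<in> graph_of f"
        using nth[OF True] by (simp add: graph_of_def)
      fix l assume l: "l < card (range f) \<and> (row_list ! k, ?s ! l) \<in> graph_of f"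
      then have "?s ! l = ?s ! \<pi> k" using nth[OF True] by (auto simp: graph_of_def)
      then show "l = \<pi> k"
        using l \<open>\<pi> k < card (range f)\<close> by (simp add: nth_eq_iff_index_eq)
    qed
    then show ?thesis using True M by (simp add: matching_perm_def row_list_def)
  next
    case False
    then show ?thesis using \<pi>' by (simp add: matching_perm_def permutes_def)
  qed
  then have "matching_perm (range f) (M (range f)) = \<pi>" by (rule ext)
  then have sgn: "matching_sign (range f) (M (range f)) = sign \<pi>"
    by (simp add: matching_sign_def)
  let ?P = "\<Otimes>r\<in>UNIV. A (r, f r)"
  have "(\<Otimes>e\<in>M (range f). A e) = ?P"
    unfolding M graph_of_def using A(1) by (subst finprod_reindex) (auto simp: inj_on_def)
  moreover have P: "?P \<in> carrier H" using A(1) by (intro finprod_closed) auto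
  moreover have "chi (map f row_list) = hsign H (sign \<pi>) \<otimes> chi ?s"
    using alternating_permute[OF alt _ \<pi>', of ?s] \<pi>(2) c by simp
  ultimately have "chi (map f row_list) = (hsign H (sign \<pi>) \<otimes> hsign H (sign \<pi>)) \<otimes> ?P"
    using chi_sorted[OF c] sgn by (simp add: m_assoc hsign_closed)
  then show ?thesis using P by (simp add: hsign_square[OF sign_cases])
qed

text \<open>Positions in an arbitrary listing \<open>L\<close> take the place of positions in the
  sorted list. The four matchings of an exchange can then be compared index by index, since their
  listings share the tail \<open>X\<close>.\<close>

lemma chi_listing:
  assumes f: "inj f" and M: "M (range f) = graph_of f"
    and L: "range f = set L" "length L = CARD('r)"
  obtains \<pi> where "\<pi> permutes {..<CARD('r)}" "\<And>k. k < CARD('r) \<Longrightarrow> L ! \<pi> k = f (row_list ! k)"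
    "(\<Otimes>r\<in>UNIV. A (r, f r)) = hsign H (sign \<pi>) \<otimes> chi L" "distinct L"
proof -
  have "card (range f) = CARD('r)" using f by (rule card_image)
  then have "distinct L" using L by (intro card_distinct) simp
  then obtain \<pi> where \<pi>: "\<pi> permutes {..<length L}" "permute_list \<pi> L = map f row_list"
    by (rule exists_permute_list[of L "map f row_list"])
      (use L row_list inj_on_subset[OF f] in \<open>auto simp: distinct_map\<close>)
  have "L ! \<pi> k = f (row_list ! k)" if "k < CARD('r)" for k
    using arg_cong[OF \<pi>(2), of "\<lambda>xs. xs ! k"] that \<pi>(1) L(2) row_list(3) by (simp add: permute_list_nth)
  moreover have "(\<Otimes>r\<in>UNIV. A (r, f r)) = hsign H (sign \<pi>) \<otimes> chi L"
    using alternating_permute[OF alt, of L \<pi>] \<pi> L(2) chi_map_row_list[OF f M] by simp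
  ultimately show thesis using that \<pi>(1) L(2) \<open>distinct L\<close> by simp
qed

text \<open>The swap preserves the product of all entries, so only signs are at stake. On
  \<open>P\<close>, \<open>f\<close> avoids \<open>b\<close> and \<open>g\<close> avoids
  \<open>d\<close>: their values keep their positions when the second entry of the listing is
  replaced. Off \<open>P\<close>, \<open>f\<close> avoids \<open>a\<close> and \<open>g\<close>
  avoids \<open>c\<close>, and the first entry may be replaced. The position permutations are
  therefore swapped exactly on \<open>P\<close>, and \<open>sign_swap_on\<close> applies.\<close>

lemma chi_exchange:
  assumes inj: "inj f" "inj g" "inj (swap_on P f g)" "inj (swap_on P g f)"
    and M: "M (range f) = graph_of f" "M (range g) = graph_of g"
      "M (range (swap_on P f g)) = graph_of (swap_on P f g)"
      "M (range (swap_on P g f)) = graph_of (swap_on P g f)"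
    and X: "length X + 2 = CARD('r)"
    and ranges: "range f = {a, b} \<union> set X" "range g = {c, d} \<union> set X"
      "range (swap_on P f g) = {c, b} \<union> set X" "range (swap_on P g f) = {a, d} \<union> set X"
    and P: "\<And>r. r \<in> P \<Longrightarrow> f r \<noteq> b \<and> g r \<noteq> d" "\<And>r. r \<notin> P \<Longrightarrow> f r \<noteq> a \<and> g r \<noteq> c"
  shows "chi (a # b # X) \<otimes> chi (c # d # X) = chi (c # b # X) \<otimes> chi (a # d # X)"
proof -
  have len: "length (p # q # X) = CARD('r)" for p q using X by simp
  let ?L1 = "a # b # X" and ?L2 = "c # d # X" and ?L3 = "c # b # X" and ?L4 = "a # d # X"
  obtain \<pi>1 where \<pi>1: "\<pi>1 permutes {..<CARD('r)}" "\<And>k. k < CARD('r) \<Longrightarrow> ?L1 ! \<pi>1 k = f (row_list ! k)"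
    "(\<Otimes>r\<in>UNIV. A (r, f r)) = hsign H (sign \<pi>1) \<otimes> chi ?L1"
    by (rule chi_listing[OF inj(1) M(1) _ len]) (use ranges in auto)
  obtain \<pi>2 where \<pi>2: "\<pi>2 permutes {..<CARD('r)}" "\<And>k. k < CARD('r) \<Longrightarrow> ?L2 ! \<pi>2 k = g (row_list ! k)"
    "(\<Otimes>r\<in>UNIV. A (r, g r)) = hsign H (sign \<pi>2) \<otimes> chi ?L2"
    by (rule chi_listing[OF inj(2) M(2) _ len]) (use ranges in auto)
  obtain \<pi>3 where \<pi>3: "\<pi>3 permutes {..<CARD('r)}"
    "\<And>k. k < CARD('r) \<Longrightarrow> ?L3 ! \<pi>3 k = swap_on P f g (row_list ! k)"
    "(\<Otimes>r\<in>UNIV. A (r, swap_on P f g r)) = hsign H (sign \<pi>3) \<otimes> chi ?L3" "distinct ?L3"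
    by (rule chi_listing[OF inj(3) M(3) _ len]) (use ranges in auto)
  obtain \<pi>4 where \<pi>4: "\<pi>4 permutes {..<CARD('r)}"
    "\<And>k. k < CARD('r) \<Longrightarrow> ?L4 ! \<pi>4 k = swap_on P g f (row_list ! k)"
    "(\<Otimes>r\<in>UNIV. A (r, swap_on P g f r)) = hsign H (sign \<pi>4) \<otimes> chi ?L4" "distinct ?L4"
    by (rule chi_listing[OF inj(4) M(4) _ len]) (use ranges in auto)
  have in_range: "\<pi> k < CARD('r)" if "\<pi> permutes {..<CARD('r)}" "k < CARD('r)" for \<pi> k
    using permutes_in_image[OF that(1), of k] that(2) by simp
  have eq3: "\<pi>3 k = j" if "k < CARD('r)" "j < CARD('r)" "?L3 ! j = swap_on P f g (row_list ! k)" for k j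
    using that \<pi>3(2)[OF that(1)] nth_eq_iff_index_eq[OF \<pi>3(4)] in_range[OF \<pi>3(1) that(1)] len by metis
  have eq4: "\<pi>4 k = j" if "k < CARD('r)" "j < CARD('r)" "?L4 ! j = swap_on P g f (row_list ! k)" for k j
    using that \<pi>4(2)[OF that(1)] nth_eq_iff_index_eq[OF \<pi>4(4)] in_range[OF \<pi>4(1) that(1)] len by metis
  have nth0: "(p # q # X) ! j = (p' # q # X) ! j" if "(p # q # X) ! j \<noteq> p" for p p' q j
    using that by (cases j) auto
  have nth1: "(p # q # X) ! j = (p # q' # X) ! j" if "(p # q # X) ! j \<noteq> q" for p q q' j
    using that by (cases j; cases "j - 1") auto
  have "sign \<pi>1 * sign \<pi>2 = sign \<pi>3 * sign \<pi>4"
  proof (rule sign_swap_on[OF \<pi>1(1) \<pi>2(1) \<pi>3(1) \<pi>4(1)])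
    fix k assume k: "k < CARD('r)"
    note r = in_range[OF \<pi>1(1) k] in_range[OF \<pi>2(1) k]
    show "\<pi>3 k = \<pi>2 k \<and> \<pi>4 k = \<pi>1 k" if "k \<in> {k. row_list ! k \<in> P}"
      using that P(1)[of "row_list ! k"] k r \<pi>1(2)[OF k] \<pi>2(2)[OF k]
        nth1[of c d "\<pi>2 k" b] nth1[of a b "\<pi>1 k" d]
      by (intro conjI eq3 eq4) (simp_all add: swap_on_def)
    show "\<pi>3 k = \<pi>1 k \<and> \<pi>4 k = \<pi>2 k" if "k \<notin> {k. row_list ! k \<in> P}"
      using that P(2)[of "row_list ! k"] k r \<pi>1(2)[OF k] \<pi>2(2)[OF k]
        nth0[of a b "\<pi>1 k" c] nth0[of c d "\<pi>2 k" a]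
      by (intro conjI eq3 eq4) (simp_all add: swap_on_def)
  qed
  define s where "s = sign \<pi>1 * sign \<pi>2"
  have s: "s \<in> {1, -1}" "s = sign \<pi>3 * sign \<pi>4"
    using sign_cases[of \<pi>1] sign_cases[of \<pi>2] \<open>sign \<pi>1 * sign \<pi>2 = _\<close> by (auto simp: s_def)
  have cl: "chi (p # q # X) \<in> carrier H" for p q
    using alternating_closed[OF alt len] .
  have prod: "(hsign H (sign \<pi>) \<otimes> chi L) \<otimes> (hsign H (sign \<rho>) \<otimes> chi L') =
      hsign H (sign \<pi> * sign \<rho>) \<otimes> (chi L \<otimes> chi L')"
    if "chi L \<in> carrier H" "chi L' \<in> carrier H" for \<pi> \<rho> L L'
    using that hsign_closed by (simp add: m_ac flip: hsign_mult[OF sign_cases sign_cases])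
  have "hsign H s \<otimes> (chi ?L1 \<otimes> chi ?L2) = (\<Otimes>r\<in>UNIV. A (r, f r)) \<otimes> (\<Otimes>r\<in>UNIV. A (r, g r))"
    using prod[of ?L1 ?L2 \<pi>1 \<pi>2] cl \<pi>1(3) \<pi>2(3) by (simp add: s_def)
  also have "\<dots> = (\<Otimes>r\<in>UNIV. A (r, f r) \<otimes> A (r, g r))"
    using A(1) by (intro finprod_multf[symmetric]) auto
  also have "\<dots> = (\<Otimes>r\<in>UNIV. A (r, swap_on P f g r) \<otimes> A (r, swap_on P g f r))"
    using A(1) by (intro finprod_cong') (auto simp: swap_on_def m_comm)
  also have "\<dots> = (\<Otimes>r\<in>UNIV. A (r, swap_on P f g r)) \<otimes> (\<Otimes>r\<in>UNIV. A (r, swap_on P g f r))"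
    using A(1) by (intro finprod_multf) auto
  also have "\<dots> = hsign H s \<otimes> (chi ?L3 \<otimes> chi ?L4)"
    using prod[of ?L3 ?L4 \<pi>3 \<pi>4] cl \<pi>3(3) \<pi>4(3) by (simp add: s(2))
  finally have "hsign H s \<otimes> (hsign H s \<otimes> (chi ?L1 \<otimes> chi ?L2)) =
      hsign H s \<otimes> (hsign H s \<otimes> (chi ?L3 \<otimes> chi ?L4))" by simp
  then show ?thesis
    using cl by (simp add: hsign_closed hsign_square[OF s(1)] flip: m_assoc)
qed

text \<open>For distinct elements the exchange supplies the opposite terms. If two of the four
  elements coincide, one term vanishes and antisymmetry makes the other two opposite. If one of them
  lies in \<open>X\<close> or \<open>X\<close> has a repetition, all terms vanish.\<close>

lemma cancelling_three_term:
  assumes X: "length X + 2 = CARD('r)"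
  shows "cancelling H (chi (x1 # x2 # X) \<otimes> chi (y1 # y2 # X))
    (chi (x1 # y1 # X) \<otimes> chi (y2 # x2 # X)) (chi (x1 # y2 # X) \<otimes> chi (x2 # y1 # X))"
proof -
  define s where "s p q = chi (p # q # X)" for p q
  have cl: "s p q \<in> carrier H" for p q
    unfolding s_def using X by (intro alternating_closed[OF alt]) simp
  have anti: "s q p = hneg H (s p q)" for p q
    unfolding s_def using X by (rule alternating_swap[OF alt])
  have zero: "s p q = hzero H" if "\<not> distinct (p # q # X)" for p q
    unfolding s_def using X that by (intro alternating_not_distinct[OF alt]) auto
  have nonzero: "s p q \<noteq> hzero H" if "distinct (p # q # X)" for p q
    unfolding s_def using X that by (intro chi_nonzero) auto
  have refl: "s p p = hzero H" for p by (rule zero) simp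
  note neg = mult_hneg[OF cl cl] hneg_mult[OF cl cl] hneg_hneg[OF m_closed[OF cl cl]] mult_zero[OF cl]
    zero_mult[OF cl] hneg_mult[OF cl hneg_closed[OF cl]] hneg_zero
  have "cancelling H (s x1 x2 \<otimes> s y1 y2) (s x1 y1 \<otimes> s y2 x2) (s x1 y2 \<otimes> s x2 y1)"
  proof (rule cancelling_if_opposite)
    let ?T1 = "s x1 x2 \<otimes> s y1 y2" and ?T2 = "s x1 y1 \<otimes> s y2 x2" and ?T3 = "s x1 y2 \<otimes> s x2 y1"
    show "?T2 = hneg H ?T1 \<and> (?T1 \<noteq> hzero H \<or> ?T3 = hzero H) \<or>
        ?T3 = hneg H ?T1 \<and> (?T1 \<noteq> hzero H \<or> ?T2 = hzero H) \<or>
        ?T3 = hneg H ?T2 \<and> (?T2 \<noteq> hzero H \<or> ?T1 = hzero H)"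
    proof (cases "distinct (x1 # x2 # y1 # y2 # X)")
      case True
      have nz: "?T1 \<noteq> hzero H" "?T2 \<noteq> hzero H" "?T3 \<noteq> hzero H"
        using True by (intro mult_nonzero(2) cl nonzero; auto)+
      obtain b c d f g P where bcd: "(b, c, d) \<in> {(x2, y1, y2), (x2, y2, y1), (y1, x2, y2), (y1, y2, x2),
          (y2, x2, y1), (y2, y1, x2)}"
        and *: "inj f" "inj g" "inj (swap_on P f g)" "inj (swap_on P g f)"
          "M (range f) = graph_of f" "M (range g) = graph_of g"
          "M (range (swap_on P f g)) = graph_of (swap_on P f g)"
          "M (range (swap_on P g f)) = graph_of (swap_on P g f)"
        and **: "range f = {x1, b} \<union> set X" "range g = {c, d} \<union> set X"
          "range (swap_on P f g) = {c, b} \<union> set X" "range (swap_on P g f) = {x1, d} \<union> set X"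
        and P: "\<And>r. r \<in> P \<Longrightarrow> f r \<noteq> b \<and> g r \<noteq> d" "\<And>r. r \<notin> P \<Longrightarrow> f r \<noteq> x1 \<and> g r \<noteq> c"
        by (rule matching_field_exchange[OF field X True]) (rule that; assumption)
      have eq: "s x1 b \<otimes> s c d = s c b \<otimes> s x1 d"
        unfolding s_def by (rule chi_exchange[OF * X ** P])
      \<comment> \<open>In each of the six cases, rewriting \<open>eq\<close> in the argument order
        of the terms reverses exactly one factor, which produces the negative.\<close>
      have "?T2 = hneg H ?T1 \<or> ?T3 = hneg H ?T1 \<or> ?T3 = hneg H ?T2"
      proof -
        consider "b = x2" "c = y1" "d = y2" | "b = x2" "c = y2" "d = y1" | "b = y1" "c = x2" "d = y2" | "b = y1" "c = y2" "d = x2" | "b = y2" "c = x2" "d = y1" | "b = y2" "c = y1" "d = x2"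
          using bcd by auto
        then show ?thesis
        proof cases
          case 1
          then show ?thesis using eq anti[of x2 y1] neg m_comm[OF cl cl] by metis
        next
          case 2
          then show ?thesis using eq anti[of y1 y2] neg m_comm[OF cl cl] by metis
        next
          case 3
          then show ?thesis using eq anti[of x2 y2] neg m_comm[OF cl cl] by metis
        next
          case 4
          then show ?thesis using eq anti[of y1 y2] neg m_comm[OF cl cl] by metis
        next
          case 5
          then show ?thesis using eq anti[of x2 y2] neg m_comm[OF cl cl] by metis
        next
          case 6
          then show ?thesis using eq anti[of x2 y1] neg m_comm[OF cl cl] by metis
        qed
      qed
      then show ?thesis using nz by blast
    next
      case False
      then consider "x1 = x2" | "y1 = y2" | "x1 = y1" | "x2 = y2" | "x1 = y2" | "x2 = y1"
        | "x1 \<in> set X \<or> x2 \<in> set X \<or> y1 \<in> set X \<or> y2 \<in> set X \<or> \<not> distinct X"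
        by auto
      then show ?thesis
      proof cases
        case 1
        then show ?thesis
          using refl[of x1] neg anti[of x1 y2] m_comm[OF cl cl] by metis
      next
        case 2
        then show ?thesis
          using refl[of y1] neg anti[of y1 x2] m_comm[OF cl cl] by metis
      next
        case 3
        then show ?thesis
          using refl[of x1] neg anti[of x1 x2] m_comm[OF cl cl] by metis
      next
        case 4
        then show ?thesis
          using refl[of x2] neg anti[of x2 y1] m_comm[OF cl cl] by metis
      next
        case 5
        then show ?thesis
          using refl[of x1] neg anti[of x1 y1] m_comm[OF cl cl] by metis
      next
        case 6
        then show ?thesis
          using refl[of x2] neg anti[of x2 y2] m_comm[OF cl cl] by metis
      next
        case 7
        then have "?T1 = hzero H \<and> ?T2 = hzero H \<and> ?T3 = hzero H"
          using zero by (auto simp: zero_mult mult_zero cl zero_closed)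
        then show ?thesis using hneg_zero by simp
      qed
    qed
  qed (auto simp: cl)
  then show ?thesis by (simp add: s_def)
qed

end

section \<open>Transport along a hyperfield morphism\<close>

lemma morphism_nonzero:
  assumes H: "hyperfield H" and H': "hyperfield H'" and \<phi>: "hyperfield_morphism H H' \<phi>"
    and x: "x \<in> carrier H" "x \<noteq> hzero H"
  shows "\<phi> x \<noteq> hzero H'"
proof
  assume 0: "\<phi> x = hzero H'"
  obtain y where y: "y \<in> carrier H" "x \<otimes>\<^bsub>H\<^esub> y = \<one>\<^bsub>H\<^esub>"
    using hyperfield.exists_inverse[OF H x] by blast
  \<comment> \<open>An inverse of \<open>x\<close> is mapped to an inverse of its image, which is
    impossible if the image is zero.\<close>
  then have "\<one>\<^bsub>H'\<^esub> = \<phi> x \<otimes>\<^bsub>H'\<^esub> \<phi> y"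
    using \<phi> x by (metis hyperfield_morphism_def)
  also have "\<dots> = hzero H'"
    using 0 \<phi> y(1) hyperfield.zero_mult[OF H'] by (auto simp: hyperfield_morphism_def)
  finally show False using hyperfield.zero_neq_one[OF H'] by simp
qed

lemma morphism_hneg:
  assumes H: "hyperfield H" and H': "hyperfield H'" and \<phi>: "hyperfield_morphism H H' \<phi>"
    and x: "x \<in> carrier H"
  shows "\<phi> (hneg H x) = hneg H' (\<phi> x)"
proof (rule hyperfield.hneg_unique[OF H'])
  note n = hyperfield.hneg_in[OF H x]
  show "\<phi> x \<in> carrier H'" "\<phi> (hneg H x) \<in> carrier H'"
    using \<phi> x n(1) by (auto simp: hyperfield_morphism_def)
  have "\<phi> (hzero H) \<in> \<phi> x \<boxplus>\<^bsub>H'\<^esub> \<phi> (hneg H x)"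
    using \<phi> x n unfolding hyperfield_morphism_def by blast
  then show "hzero H' \<in> \<phi> x \<boxplus>\<^bsub>H'\<^esub> \<phi> (hneg H x)"
    using \<phi> by (simp add: hyperfield_morphism_def)
qed

text \<open>Negatives are preserved, and the side condition survives because a nonzero
  \<open>u\<close> has a nonzero image.\<close>

lemma morphism_cancelling:
  assumes "hyperfield H" "hyperfield H'" and \<phi>: "hyperfield_morphism H H' \<phi>"
    and "cancelling H a b c"
  shows "cancelling H' (\<phi> a) (\<phi> b) (\<phi> c)"
proof -
  obtain u v where uv: "u \<in> carrier H" "v \<in> carrier H" "u \<noteq> hzero H \<or> v = hzero H"
    "a = u \<and> b = hneg H u \<and> c = v \<or> a = u \<and> b = v \<and> c = hneg H u \<or> a = v \<and> b = u \<and> c = hneg H u"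
    using assms(4) by (auto simp: cancelling_def)
  have "\<phi> u \<noteq> hzero H' \<or> \<phi> v = hzero H'"
    using uv morphism_nonzero[OF assms(1-3)] \<phi> by (metis hyperfield_morphism_def)
  moreover have "\<phi> u \<in> carrier H'" "\<phi> v \<in> carrier H'"
    using uv \<phi> by (auto simp: hyperfield_morphism_def)
  ultimately show ?thesis
    unfolding cancelling_def using uv(4) morphism_hneg[OF assms(1-3) uv(1)] by metis
qed

lemma morphism_alternating:
  assumes H: "hyperfield H" and H': "hyperfield H'" and \<phi>: "hyperfield_morphism H H' \<phi>"
    and alt: "alternating H d chi"
  shows "alternating H' d (\<phi> \<circ> chi)"
proof -
  have "\<phi> (hsign H s) = hsign H' s" for s
    using morphism_hneg[OF H H' \<phi> hyperfield.one_closed[OF H]] \<phi>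
    by (simp add: hsign_def hyperfield_morphism_def)
  then show ?thesis
    using alt \<phi> hyperfield.hsign_closed[OF H]
    by (auto simp: alternating_def hyperfield_morphism_def)
qed

theorem corollary5p11:
  fixes M :: "'e::{finite,linorder} set \<Rightarrow> ('r::{finite,linorder} \<times> 'e) set"
    and H :: "'h hyperstruct"
    and A :: "'r \<times> 'e \<Rightarrow> 'h"
    and chi :: "'e list \<Rightarrow> 'h"
  assumes "CARD('r) \<le> CARD('e)"
    and "polyhedral_matching_field M"
    and "hyperfield H"
    and "\<And>e. A e \<in> carrier H" and "\<And>e. A e \<noteq> hzero H"
    and "alternating H CARD('r) chi"
    and "\<And>\<sigma>. card \<sigma> = CARD('r) \<Longrightarrow>
           chi (sorted_list_of_set \<sigma>) =
             hsign H (matching_sign \<sigma> (M \<sigma>)) \<otimes>\<^bsub>H\<^esub> (\<Otimes>\<^bsub>H\<^esub>e\<in>M \<sigma>. A e)"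
  shows "weak_matroid (canonical_inflation H) CARD('r) chi \<and>
    (\<forall>(H' :: 'k hyperstruct) \<phi>.
       hyperfield H' \<longrightarrow> inflation_property H' \<longrightarrow> hyperfield_morphism H H' \<phi> \<longrightarrow>
       weak_matroid H' CARD('r) (\<phi> \<circ> chi))"
proof -
  interpret hyperfield H by fact
  interpret matching_field_function H M A chi
    using assms by unfold_locales auto
  show ?thesis
  proof (intro conjI allI impI)
    let ?K = "canonical_inflation H"
    have sel: "carrier ?K = carrier H" "hzero ?K = hzero H" "(\<otimes>\<^bsub>?K\<^esub>) = (\<otimes>\<^bsub>H\<^esub>)" "\<one>\<^bsub>?K\<^esub> = \<one>\<^bsub>H\<^esub>"
      by (simp_all add: canonical_inflation_def)
    \<comment> \<open>Alternation involves only the carrier, zero, products and signs, and the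
      inflation shares all of these with \<open>H\<close>.\<close>
    have "hsign ?K s = hsign H s" for s
      by (simp add: hsign_def sel hneg_canonical_inflation one_closed)
    then have "alternating ?K CARD('r) chi"
      using alt by (simp add: alternating_def sel)
    then show "weak_matroid ?K CARD('r) chi"
      using assms(1) chi_nonzero zero_in_hadd3_canonical_inflation[OF cancelling_three_term]
      by (intro weak_matroidI) (simp_all add: sel)
  next
    fix H' :: "'k hyperstruct" and \<phi>
    assume H': "hyperfield H'" "inflation_property H'" and \<phi>: "hyperfield_morphism H H' \<phi>"
    show "weak_matroid H' CARD('r) (\<phi> \<circ> chi)"
    proof (rule weak_matroidI)
      show "alternating H' CARD('r) (\<phi> \<circ> chi)"
        by (rule morphism_alternating[OF assms(3) H'(1) \<phi> alt])
      show "(\<phi> \<circ> chi) xs \<noteq> hzero H'" if "length xs = CARD('r)" "distinct xs" for xs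
        using that chi_nonzero alternating_closed[OF alt] morphism_nonzero[OF assms(3) H'(1) \<phi>] by simp
      fix x1 x2 y1 y2 :: 'e and X :: "'e list" assume X: "length X + 2 = CARD('r)"
      have cl: "chi (p # q # X) \<in> carrier H" for p q
        using X by (intro alternating_closed[OF alt]) simp
      have "\<phi> (chi (p # q # X) \<otimes>\<^bsub>H\<^esub> chi (p' # q' # X)) =
          (\<phi> \<circ> chi) (p # q # X) \<otimes>\<^bsub>H'\<^esub> (\<phi> \<circ> chi) (p' # q' # X)" for p q p' q'
        using \<phi> cl by (simp add: hyperfield_morphism_def)
      then show "hzero H' \<in> hadd3 H'
          ((\<phi> \<circ> chi) (x1 # x2 # X) \<otimes>\<^bsub>H'\<^esub> (\<phi> \<circ> chi) (y1 # y2 # X))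
          ((\<phi> \<circ> chi) (x1 # y1 # X) \<otimes>\<^bsub>H'\<^esub> (\<phi> \<circ> chi) (y2 # x2 # X))
          ((\<phi> \<circ> chi) (x1 # y2 # X) \<otimes>\<^bsub>H'\<^esub> (\<phi> \<circ> chi) (x2 # y1 # X))"
        using hyperfield.zero_in_hadd3_inflation_property[OF H'
            morphism_cancelling[OF assms(3) H'(1) \<phi> cancelling_three_term[OF X]]]
        by simp
    qed (fact assms(1))
  qed
qed

end
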